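(* Let $\Omega\subsetneq\mathcal{X}$ be a complete Kobayashi hyperbolic domain in a complex manifold $\mathcal{X}$, with $\overline\Omega^{\mathrm{End}}$ sequentially compact. Suppose that for a fixed $p\in\Omega$ and any $x\in\partial\overline\Omega^{\mathrm{End}}$ we have $$\bigcap_{R>0}\overline{H^b_p(x,R)}=\{x\}.$$ Then, for any $x\in\partial\overline\Omega^{\mathrm{End}}$ and any $\xi\in\mathscr{H}(x)$, we also have $$\bigcap_{R>0}\overline{H_p(\xi,R)}=\{x\}.$$ In particular, there exists a continuous surjective map $F:\overline\Omega^{\mathsf{k}}\to\overline\Omega^{\mathrm{End}}$ such that $F\circ i_{\mathsf{k}}=i_\Omega$ on $\Omega$, where $i_\Omega:\Omega\to\overline\Omega^{\mathrm{End}}$ is the inclusion. (All closures of horospheres and horoballs are taken in $\overline\Omega^{\mathrm{End}}$.)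
   Context: $\mathsf{k}_\Omega$ is the Kobayashi distance of $\Omega$; $\Omega$ is complete Kobayashi hyperbolic if $\mathsf{k}_\Omega$ is a genuine distance and $(\Omega,\mathsf{k}_\Omega)$ is complete. A domain is a nonempty connected open set; $\overline\Omega$ is the closure of $\Omega$ in $\mathcal{X}$. Limits $w\to x$ are taken with $w\in\Omega$, in the topology of $\overline\Omega^{\mathrm{End}}$. End compactification: let $(K_j)_{j\ge1}$ be an exhaustion of $\overline\Omega$ by compact sets with $K_j\subset\mathrm{int}(K_{j+1})$. An end is a sequence $(F_j)_{j\ge1}$ where $F_j$ is a connected component of $\overline\Omega\setminus K_j$ and $F_{j+1}\subset F_j$. With $\mathcal{E}$ the set of ends, $\overline\Omega^{\mathrm{End}}=\overline\Omega\sqcup\mathcal{E}$. A neighbourhood basis at $x\in\overline\Omega$ is given by the sets $U\cap\overline\Omega$, $U$ a neighbourhood of $x$ in $\mathcal{X}$; at an end $e=(F_j)$ it is given by $\widehat F_j=F_j\sqcup\{(G_\nu)\in\mathcal{E}: G_\nu=F_\nu,\ \nu=1,\dots,j\}$, $j\ge1$. This is a first-countable Hausdorff topology independent of the exhaustion. $\partial\overline\Omega^{\mathrm{End}}=\overline\Omega^{\mathrm{End}}\setminus\Omega$. Metric compactification of $(\Omega,\mathsf{k}_\Omega)$: let $C(\Omega)$ be the real-valued continuous functions on $\Omega$ with the topology of local uniform convergence, $C_*(\Omega)$ its quotient by the constant functions with the quotient topology, and $i_{\mathsf{k}}:\Omega\to C_*(\Omega)$, $i_{\mathsf{k}}(x)=[\mathsf{k}_\Omega(x,\cdot)]$.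 Then $\overline\Omega^{\mathsf{k}}$ is the closure of $i_{\mathsf{k}}(\Omega)$ in $C_*(\Omega)$ and $\partial\overline\Omega^{\mathsf{k}}=\overline\Omega^{\mathsf{k}}\setminus i_{\mathsf{k}}(\Omega)$. For $\xi\in\partial\overline\Omega^{\mathsf{k}}$, $h_{p,\xi}$ is the unique function in the class $\xi$ with $h_{p,\xi}(p)=0$, and for $R>0$, $H_p(\xi,R)=\{z\in\Omega: h_{p,\xi}(z)<\frac12\log R\}$. For $x\in\partial\overline\Omega^{\mathrm{End}}$: $\mathscr{H}(x)=\{\xi\in\overline\Omega^{\mathsf{k}}\setminus i_{\mathsf{k}}(\Omega): \exists (x_n)\subset\Omega \text{ with } x_n\to x \text{ in } \overline\Omega^{\mathrm{End}} \text{ and } i_{\mathsf{k}}(x_n)\to\xi\}$, and for $R>0$, $H^b_p(x,R)=\{z\in\Omega:\liminf_{w\to x}(\mathsf{k}_\Omega(z,w)-\mathsf{k}_\Omega(p,w))<\frac12\log R\}$. *)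

theory Defs
  imports "HOL-Analysis.Analysis"
begin

section \<open>Complex manifolds\<close>

text \<open>Holomorphy in several variables: real differentiability with a complex linear derivative.
  It is only used on open sets.\<close>

definition holomorphic_map_on :: "(complex^'n::finite \<Rightarrow> complex^'m::finite) \<Rightarrow> (complex^'n) set \<Rightarrow> bool"
  where "holomorphic_map_on f S \<longleftrightarrow>
    (\<forall>z\<in>S. \<exists>D. (f has_derivative D) (at z) \<and> (\<forall>c v. D (c *s v) = c *s D v))"

text \<open>The underlying space is a topology \<open>X\<close> whose points are \<open>topspace X\<close>. The dimension is
  \<open>CARD('n)\<close>. Neither connectedness of \<open>X\<close> nor maximality of the atlas is required.\<close>

definition complex_manifold :: "'a topology \<Rightarrow> ('a set \<times> ('a \<Rightarrow> complex^'n::finite)) set \<Rightarrow> bool"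
  where "complex_manifold X A \<longleftrightarrow>
    Hausdorff_space X \<and> second_countable X \<and>
    (\<Union>(U,\<phi>)\<in>A. U) = topspace X \<and>
    (\<forall>(U,\<phi>)\<in>A. openin X U \<and> open (\<phi> ` U) \<and>
       homeomorphic_map (subtopology X U) (top_of_set (\<phi> ` U)) \<phi>) \<and>
    (\<forall>(U,\<phi>)\<in>A. \<forall>(V,\<psi>)\<in>A. holomorphic_map_on (\<psi> \<circ> inv_into U \<phi>) (\<phi> ` (U \<inter> V)))"

definition domain_in :: "'a topology \<Rightarrow> 'a set \<Rightarrow> bool"
  where "domain_in X \<Omega> \<longleftrightarrow> \<Omega> \<noteq> {} \<and> openin X \<Omega> \<and> connectedin X \<Omega>"


section \<open>Kobayashi distance\<close>

definition holomorphic_disc ::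
  "'a topology \<Rightarrow> ('a set \<times> ('a \<Rightarrow> complex^'n::finite)) set \<Rightarrow> 'a set \<Rightarrow> (complex \<Rightarrow> 'a) \<Rightarrow> bool"
  where "holomorphic_disc X A \<Omega> f \<longleftrightarrow>
    continuous_map (top_of_set (ball 0 1)) X f \<and> f ` ball 0 1 \<subseteq> \<Omega> \<and>
    (\<forall>(U,\<phi>)\<in>A. \<forall>i. (\<lambda>\<zeta>. \<phi> (f \<zeta>) $ i) holomorphic_on {\<zeta> \<in> ball 0 1. f \<zeta> \<in> U})"

text \<open>Normalised so that the distance from \<open>0\<close> to \<open>\<zeta>\<close> is
  \<open>1/2 log ((1 + \<bar>\<zeta>\<bar>) / (1 - \<bar>\<zeta>\<bar>))\<close>, in accordance with the factor \<open>1/2\<close> in the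
  horospheres below.\<close>

definition poincare_dist :: "complex \<Rightarrow> complex \<Rightarrow> real"
  where "poincare_dist a b = artanh (cmod ((a - b) / (1 - cnj a * b)))"

text \<open>The infimum runs over chains of holomorphic discs from \<open>x\<close> to \<open>y\<close>; such chains exist
  whenever \<open>\<Omega>\<close> is connected. The value 0 off \<open>\<Omega>\<close> is a convention making the function total;
  it is needed since \<^locale>\<open>Metric_space\<close> also demands nonnegativity and symmetry off the
  carrier.\<close>

definition kobayashi ::
  "'a topology \<Rightarrow> ('a set \<times> ('a \<Rightarrow> complex^'n::finite)) set \<Rightarrow> 'a set \<Rightarrow> 'a \<Rightarrow> 'a \<Rightarrow> real"
  where "kobayashi X A \<Omega> x y =
    (if x \<in> \<Omega> \<and> y \<in> \<Omega> then
       Inf {\<Sum>i<n. poincare_dist (a i) (b i) | (n::nat) f a b q.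
              q 0 = x \<and> q n = y \<and>
              (\<forall>i<n. holomorphic_disc X A \<Omega> (f i) \<and> a i \<in> ball 0 1 \<and> b i \<in> ball 0 1 \<and>
                     f i (a i) = q i \<and> f i (b i) = q (Suc i))}
     else 0)"

definition complete_kobayashi_hyperbolic ::
  "'a topology \<Rightarrow> ('a set \<times> ('a \<Rightarrow> complex^'n::finite)) set \<Rightarrow> 'a set \<Rightarrow> bool"
  where "complete_kobayashi_hyperbolic X A \<Omega> \<longleftrightarrow>
    Metric_space \<Omega> (kobayashi X A \<Omega>) \<and> Metric_space.mcomplete \<Omega> (kobayashi X A \<Omega>)"


section \<open>End compactification\<close>

text \<open>Here \<open>Y\<close> is the closure of the domain with its subspace topology. Points of \<open>Y\<close> are tagged
  with \<^const>\<open>Inl\<close> and ends with \<^const>\<open>Inr\<close>; exhaustions are indexed from 0.\<close>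

definition compact_exhaustion :: "'a topology \<Rightarrow> (nat \<Rightarrow> 'a set) \<Rightarrow> bool"
  where "compact_exhaustion Y K \<longleftrightarrow>
    (\<forall>j. compactin Y (K j) \<and> K j \<subseteq> Y interior_of K (Suc j)) \<and> (\<Union>j. K j) = topspace Y"

definition ends :: "'a topology \<Rightarrow> (nat \<Rightarrow> 'a set) \<Rightarrow> (nat \<Rightarrow> 'a set) set"
  where "ends Y K = {F. \<forall>j. F j \<in> connected_components_of (subtopology Y (topspace Y - K j)) \<and>
                            F (Suc j) \<subseteq> F j}"

definition end_nbhd ::
  "'a topology \<Rightarrow> (nat \<Rightarrow> 'a set) \<Rightarrow> (nat \<Rightarrow> 'a set) \<Rightarrow> nat \<Rightarrow> ('a + (nat \<Rightarrow> 'a set)) set"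
  where "end_nbhd Y K F j = Inl ` F j \<union> Inr ` {G \<in> ends Y K. \<forall>\<nu>\<le>j. G \<nu> = F \<nu>}"

text \<open>A set is open iff it contains a basic neighbourhood of each of its points. If \<open>Y\<close> is not
  locally connected, the basic neighbourhoods \<open>end_nbhd Y K F j\<close> need not be open themselves.\<close>

definition end_open ::
  "'a topology \<Rightarrow> (nat \<Rightarrow> 'a set) \<Rightarrow> ('a + (nat \<Rightarrow> 'a set)) set \<Rightarrow> bool"
  where "end_open Y K W \<longleftrightarrow>
    W \<subseteq> Inl ` topspace Y \<union> Inr ` ends Y K \<and>
    (\<forall>z. Inl z \<in> W \<longrightarrow> (\<exists>V. openin Y V \<and> z \<in> V \<and> Inl ` V \<subseteq> W)) \<and>
    (\<forall>F. Inr F \<in> W \<longrightarrow> (\<exists>j. end_nbhd Y K F j \<subseteq> W))"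

definition end_topology :: "'a topology \<Rightarrow> (nat \<Rightarrow> 'a set) \<Rightarrow> ('a + (nat \<Rightarrow> 'a set)) topology"
  where "end_topology Y K = topology (end_open Y K)"

lemma end_nbhd_antimono:
  assumes "F \<in> ends Y K" "i \<le> j"
  shows "end_nbhd Y K F j \<subseteq> end_nbhd Y K F i"
proof -
  have "F j \<subseteq> F i"
    by (rule lift_Suc_antimono_le[OF _ assms(2)]) (use assms(1) in \<open>simp add: ends_def\<close>)
  then show ?thesis
    using assms(2) by (auto simp: end_nbhd_def)
qed

lemma end_openD:
  assumes "end_open Y K W"
  shows "W \<subseteq> Inl ` topspace Y \<union> Inr ` ends Y K"
    and "Inl z \<in> W \<Longrightarrow> \<exists>V. openin Y V \<and> z \<in> V \<and> Inl ` V \<subseteq> W"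
    and "Inr F \<in> W \<Longrightarrow> \<exists>j. end_nbhd Y K F j \<subseteq> W"
  using assms by (simp_all only: end_open_def)

lemma end_openI:
  assumes "W \<subseteq> Inl ` topspace Y \<union> Inr ` ends Y K"
    and "\<And>z. Inl z \<in> W \<Longrightarrow> \<exists>V. openin Y V \<and> z \<in> V \<and> Inl ` V \<subseteq> W"
    and "\<And>F. Inr F \<in> W \<Longrightarrow> \<exists>j. end_nbhd Y K F j \<subseteq> W"
  shows "end_open Y K W"
  unfolding end_open_def
  by (intro conjI allI impI) (assumption | rule assms)+

lemma istopology_end_open: "istopology (end_open Y K)"
  unfolding istopology_def
proof (intro conjI allI impI)
  fix S T assume S: "end_open Y K S" and T: "end_open Y K T"
  show "end_open Y K (S \<inter> T)"
  proof (rule end_openI)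
    show "S \<inter> T \<subseteq> Inl ` topspace Y \<union> Inr ` ends Y K"
      using end_openD(1)[OF S] by (rule le_infI1)
  next
    fix z assume z: "Inl z \<in> S \<inter> T"
    obtain V where V: "openin Y V \<and> z \<in> V \<and> Inl ` V \<subseteq> S"
      using end_openD(2)[OF S IntD1[OF z]] ..
    obtain W where W: "openin Y W \<and> z \<in> W \<and> Inl ` W \<subseteq> T"
      using end_openD(2)[OF T IntD2[OF z]] ..
    have "openin Y (V \<inter> W) \<and> z \<in> V \<inter> W \<and> Inl ` (V \<inter> W) \<subseteq> S \<inter> T"
      using V W by auto
    then show "\<exists>V. openin Y V \<and> z \<in> V \<and> Inl ` V \<subseteq> S \<inter> T" ..
  next
    fix F assume F: "Inr F \<in> S \<inter> T"
    have "Inr F \<in> Inl ` topspace Y \<union> Inr ` ends Y K"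
      using end_openD(1)[OF S] IntD1[OF F] by (rule subsetD)
    then have ends: "F \<in> ends Y K" by auto
    obtain i where i: "end_nbhd Y K F i \<subseteq> S"
      using end_openD(3)[OF S IntD1[OF F]] ..
    obtain j where j: "end_nbhd Y K F j \<subseteq> T"
      using end_openD(3)[OF T IntD2[OF F]] ..
    have "end_nbhd Y K F (max i j) \<subseteq> S \<inter> T"
      using subset_trans[OF end_nbhd_antimono[OF ends max.cobounded1[of i j]] i]
        subset_trans[OF end_nbhd_antimono[OF ends max.cobounded2[of j i]] j]
      by (rule Int_greatest)
    then show "\<exists>j. end_nbhd Y K F j \<subseteq> S \<inter> T" ..
  qed
next
  fix \<W> assume \<W>: "\<forall>W\<in>\<W>. end_open Y K W"
  show "end_open Y K (\<Union>\<W>)"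
  proof (rule end_openI)
    show "\<Union>\<W> \<subseteq> Inl ` topspace Y \<union> Inr ` ends Y K"
      by (intro Union_least end_openD(1)) (rule bspec[OF \<W>])
  next
    fix z assume "Inl z \<in> \<Union>\<W>"
    then obtain W where W: "W \<in> \<W>" "Inl z \<in> W" by (rule UnionE)
    obtain V where V: "openin Y V \<and> z \<in> V \<and> Inl ` V \<subseteq> W"
      using end_openD(2)[OF bspec[OF \<W> W(1)] W(2)] ..
    have "openin Y V \<and> z \<in> V \<and> Inl ` V \<subseteq> \<Union>\<W>"
      using V subset_trans[OF _ Union_upper[OF W(1)]] by simp
    then show "\<exists>V. openin Y V \<and> z \<in> V \<and> Inl ` V \<subseteq> \<Union>\<W>" ..
  next
    fix F assume "Inr F \<in> \<Union>\<W>"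
    then obtain W where W: "W \<in> \<W>" "Inr F \<in> W" by (rule UnionE)
    obtain j where j: "end_nbhd Y K F j \<subseteq> W"
      using end_openD(3)[OF bspec[OF \<W> W(1)] W(2)] ..
    show "\<exists>j. end_nbhd Y K F j \<subseteq> \<Union>\<W>"
      using subset_trans[OF j Union_upper[OF W(1)]] ..
  qed
qed

lemma openin_end_topology: "openin (end_topology Y K) W \<longleftrightarrow> end_open Y K W"
  by (simp only: end_topology_def topology_inverse'[OF istopology_end_open])

lemma topspace_end_topology:
  "topspace (end_topology Y K) = Inl ` topspace Y \<union> Inr ` ends Y K"
proof -
  have carrier: "end_open Y K (Inl ` topspace Y \<union> Inr ` ends Y K)"
  proof (rule end_openI)
    show "Inl ` topspace Y \<union> Inr ` ends Y K \<subseteq> Inl ` topspace Y \<union> Inr ` ends Y K"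
      by (rule subset_refl)
  next
    fix z :: 'a assume "Inl z \<in> Inl ` topspace Y \<union> Inr ` ends Y K"
    then have "z \<in> topspace Y" by auto
    then have "openin Y (topspace Y) \<and> z \<in> topspace Y \<and>
        Inl ` topspace Y \<subseteq> Inl ` topspace Y \<union> Inr ` ends Y K"
      by simp
    then show "\<exists>V. openin Y V \<and> z \<in> V \<and> Inl ` V \<subseteq> Inl ` topspace Y \<union> Inr ` ends Y K" ..
  next
    fix F :: "nat \<Rightarrow> 'a set" assume "Inr F \<in> Inl ` topspace Y \<union> Inr ` ends Y K"
    then have "F \<in> ends Y K" by auto
    then have "F 0 \<in> connected_components_of (subtopology Y (topspace Y - K 0))"
      by (simp add: ends_def)
    then have "F 0 \<subseteq> topspace Y"
      using connected_components_of_subset topspace_subtopology_subset by fastforce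
    then have "end_nbhd Y K F 0 \<subseteq> Inl ` topspace Y \<union> Inr ` ends Y K"
      unfolding end_nbhd_def by (intro Un_mono image_mono) simp_all
    then show "\<exists>j. end_nbhd Y K F j \<subseteq> Inl ` topspace Y \<union> Inr ` ends Y K" ..
  qed
  have "end_open Y K (topspace (end_topology Y K))"
    using openin_topspace[of "end_topology Y K"] unfolding openin_end_topology .
  then have "topspace (end_topology Y K) \<subseteq> Inl ` topspace Y \<union> Inr ` ends Y K"
    unfolding end_open_def by (rule conjunct1)
  moreover have "Inl ` topspace Y \<union> Inr ` ends Y K \<subseteq> topspace (end_topology Y K)"
    by (rule openin_subset[OF openin_end_topology[THEN iffD2, OF carrier]])
  ultimately show ?thesis
    by (rule subset_antisym)
qed

text \<open>The end compactification of the closure of \<open>\<Omega>\<close> in \<open>X\<close>, its boundary, and the filter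
  of \<open>w \<in> \<Omega>\<close> tending to \<open>x\<close>. The inclusion of \<open>\<Omega>\<close> is \<^const>\<open>Inl\<close>.\<close>

definition end_compactification ::
  "'a topology \<Rightarrow> 'a set \<Rightarrow> (nat \<Rightarrow> 'a set) \<Rightarrow> ('a + (nat \<Rightarrow> 'a set)) topology"
  where "end_compactification X \<Omega> K = end_topology (subtopology X (X closure_of \<Omega>)) K"

definition end_boundary ::
  "'a topology \<Rightarrow> 'a set \<Rightarrow> (nat \<Rightarrow> 'a set) \<Rightarrow> ('a + (nat \<Rightarrow> 'a set)) set"
  where "end_boundary X \<Omega> K = topspace (end_compactification X \<Omega> K) - Inl ` \<Omega>"

definition tending_to ::
  "'a topology \<Rightarrow> 'a set \<Rightarrow> (nat \<Rightarrow> 'a set) \<Rightarrow> 'a + (nat \<Rightarrow> 'a set) \<Rightarrow> 'a filter"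
  where "tending_to X \<Omega> K x =
    inf (filtercomap Inl (nhdsin (end_compactification X \<Omega> K) x)) (principal \<Omega>)"

definition sequentially_compact_space :: "'a topology \<Rightarrow> bool"
  where "sequentially_compact_space T \<longleftrightarrow>
    (\<forall>\<sigma>::nat \<Rightarrow> 'a. range \<sigma> \<subseteq> topspace T \<longrightarrow>
       (\<exists>l r. strict_mono r \<and> limitin T (\<sigma> \<circ> r) l sequentially))"


section \<open>Metric compactification\<close>

text \<open>In this section \<open>T\<close> is a topology (here locally compact) and \<open>d\<close> a continuous distance on
  its points. Functions on \<open>topspace T\<close> are represented by extensional functions, and elements
  of the quotient by equivalence classes of such functions.\<close>

definition cont_funs :: "'a topology \<Rightarrow> ('a \<Rightarrow> real) set"
  where "cont_funs T = {f \<in> extensional (topspace T). continuous_map T euclideanreal f}"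

definition cont_open :: "'a topology \<Rightarrow> ('a \<Rightarrow> real) set \<Rightarrow> bool"
  where "cont_open T W \<longleftrightarrow> W \<subseteq> cont_funs T \<and>
    (\<forall>f\<in>W. \<exists>C \<epsilon>. compactin T C \<and> 0 < \<epsilon> \<and>
       {g \<in> cont_funs T. \<forall>z\<in>C. \<bar>g z - f z\<bar> < \<epsilon>} \<subseteq> W)"

text \<open>Uniform convergence on compact sets, which on locally compact spaces is local uniform
  convergence.\<close>

definition cont_topology :: "'a topology \<Rightarrow> ('a \<Rightarrow> real) topology"
  where "cont_topology T = topology (cont_open T)"

lemma cont_openD:
  assumes "cont_open T W"
  shows "W \<subseteq> cont_funs T"
    and "f \<in> W \<Longrightarrow> \<exists>C \<epsilon>. compactin T C \<and> 0 < \<epsilon> \<and>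
           {g \<in> cont_funs T. \<forall>z\<in>C. \<bar>g z - f z\<bar> < \<epsilon>} \<subseteq> W"
  using assms by (simp_all only: cont_open_def)

lemma cont_openI:
  assumes "W \<subseteq> cont_funs T"
    and "\<And>f. f \<in> W \<Longrightarrow> \<exists>C \<epsilon>. compactin T C \<and> 0 < \<epsilon> \<and>
           {g \<in> cont_funs T. \<forall>z\<in>C. \<bar>g z - f z\<bar> < \<epsilon>} \<subseteq> W"
  shows "cont_open T W"
  unfolding cont_open_def by (intro conjI ballI) (assumption | rule assms)+

lemma istopology_cont_open: "istopology (cont_open T)"
  unfolding istopology_def
proof (intro conjI allI impI)
  fix S W assume S: "cont_open T S" and W: "cont_open T W"
  show "cont_open T (S \<inter> W)"
  proof (rule cont_openI)
    show "S \<inter> W \<subseteq> cont_funs T"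
      using cont_openD(1)[OF S] by (rule le_infI1)
  next
    fix f assume f: "f \<in> S \<inter> W"
    obtain C \<epsilon> where 1: "compactin T C" "0 < \<epsilon>"
        "{g \<in> cont_funs T. \<forall>z\<in>C. \<bar>g z - f z\<bar> < \<epsilon>} \<subseteq> S"
      using cont_openD(2)[OF S IntD1[OF f]] by (elim exE conjE)
    obtain D \<delta> where 2: "compactin T D" "0 < \<delta>"
        "{g \<in> cont_funs T. \<forall>z\<in>D. \<bar>g z - f z\<bar> < \<delta>} \<subseteq> W"
      using cont_openD(2)[OF W IntD2[OF f]] by (elim exE conjE)
    have "{g \<in> cont_funs T. \<forall>z\<in>C \<union> D. \<bar>g z - f z\<bar> < min \<epsilon> \<delta>} \<subseteq>
        {g \<in> cont_funs T. \<forall>z\<in>C. \<bar>g z - f z\<bar> < \<epsilon>} \<inter> {g \<in> cont_funs T. \<forall>z\<in>D. \<bar>g z - f z\<bar> < \<delta>}"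
      by auto
    also have "\<dots> \<subseteq> S \<inter> W"
      using 1(3) 2(3) by (rule Int_mono)
    finally have "{g \<in> cont_funs T. \<forall>z\<in>C \<union> D. \<bar>g z - f z\<bar> < min \<epsilon> \<delta>} \<subseteq> S \<inter> W" .
    moreover have "compactin T (C \<union> D)"
      using 1(1) 2(1) by (rule compactin_Un)
    moreover have "0 < min \<epsilon> \<delta>"
      using 1(2) 2(2) by (rule min_less_iff_conj[THEN iffD2, OF conjI])
    ultimately show "\<exists>C \<epsilon>. compactin T C \<and> 0 < \<epsilon> \<and>
        {g \<in> cont_funs T. \<forall>z\<in>C. \<bar>g z - f z\<bar> < \<epsilon>} \<subseteq> S \<inter> W"
      by (intro exI[of _ "C \<union> D"] exI[of _ "min \<epsilon> \<delta>"] conjI)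
  qed
next
  fix \<W> assume \<W>: "\<forall>W\<in>\<W>. cont_open T W"
  show "cont_open T (\<Union>\<W>)"
  proof (rule cont_openI)
    show "\<Union>\<W> \<subseteq> cont_funs T"
      by (intro Union_least cont_openD(1)) (rule bspec[OF \<W>])
  next
    fix f assume "f \<in> \<Union>\<W>"
    then obtain W where W: "W \<in> \<W>" "f \<in> W" by (rule UnionE)
    obtain C \<epsilon> where C: "compactin T C" "0 < \<epsilon>"
        "{g \<in> cont_funs T. \<forall>z\<in>C. \<bar>g z - f z\<bar> < \<epsilon>} \<subseteq> W"
      using cont_openD(2)[OF bspec[OF \<W> W(1)] W(2)] by (elim exE conjE)
    show "\<exists>C \<epsilon>. compactin T C \<and> 0 < \<epsilon> \<and>
        {g \<in> cont_funs T. \<forall>z\<in>C. \<bar>g z - f z\<bar> < \<epsilon>} \<subseteq> \<Union>\<W>"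
      by (intro exI[of _ C] exI[of _ \<epsilon>] conjI C(1,2) subset_trans[OF C(3) Union_upper[OF W(1)]])
  qed
qed

lemma openin_cont_topology: "openin (cont_topology T) W \<longleftrightarrow> cont_open T W"
  by (simp only: cont_topology_def topology_inverse'[OF istopology_cont_open])

lemma topspace_cont_topology: "topspace (cont_topology T) = cont_funs T"
proof -
  have carrier: "cont_open T (cont_funs T)"
    unfolding cont_open_def by (auto intro!: exI[of _ "{}"] exI[of _ "1::real"])
  have "cont_open T (topspace (cont_topology T))"
    using openin_topspace[of "cont_topology T"] unfolding openin_cont_topology .
  then have "topspace (cont_topology T) \<subseteq> cont_funs T"
    unfolding cont_open_def by (rule conjunct1)
  moreover have "cont_funs T \<subseteq> topspace (cont_topology T)"
    by (rule openin_subset[OF openin_cont_topology[THEN iffD2, OF carrier]])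
  ultimately show ?thesis
    by (rule subset_antisym)
qed

definition differ_by_const :: "'a topology \<Rightarrow> (('a \<Rightarrow> real) \<times> ('a \<Rightarrow> real)) set"
  where "differ_by_const T =
    {(f, g). f \<in> cont_funs T \<and> g \<in> cont_funs T \<and> (\<exists>c. \<forall>z\<in>topspace T. g z = f z + c)}"

definition mod_const :: "'a topology \<Rightarrow> ('a \<Rightarrow> real) \<Rightarrow> ('a \<Rightarrow> real) set"
  where "mod_const T f = differ_by_const T `` {f}"

lemma equiv_differ_by_const: "equiv (cont_funs T) (differ_by_const T)"
proof (rule equivI)
  show "differ_by_const T \<subseteq> cont_funs T \<times> cont_funs T"
    by (auto simp: differ_by_const_def)
  show "refl_on (cont_funs T) (differ_by_const T)"
    by (auto simp: differ_by_const_def refl_on_def intro: exI[of _ "0::real"])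
  show "sym (differ_by_const T)"
  proof (rule symI)
    fix f g assume "(f, g) \<in> differ_by_const T"
    then obtain c where "f \<in> cont_funs T" "g \<in> cont_funs T" "\<forall>z\<in>topspace T. g z = f z + c"
      by (auto simp: differ_by_const_def)
    then show "(g, f) \<in> differ_by_const T"
      by (auto simp: differ_by_const_def intro!: exI[of _ "- c"])
  qed
  show "trans (differ_by_const T)"
  proof (rule transI)
    fix f g h assume "(f, g) \<in> differ_by_const T" "(g, h) \<in> differ_by_const T"
    then obtain c d where "f \<in> cont_funs T" "h \<in> cont_funs T"
        "\<forall>z\<in>topspace T. g z = f z + c" "\<forall>z\<in>topspace T. h z = g z + d"
      unfolding differ_by_const_def by blast
    then show "(f, h) \<in> differ_by_const T"
      by (auto simp: differ_by_const_def intro!: exI[of _ "c + d"])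
  qed
qed

definition cont_mod_const_topology :: "'a topology \<Rightarrow> ('a \<Rightarrow> real) set topology"
  where "cont_mod_const_topology T =
    topology (\<lambda>W. W \<subseteq> cont_funs T // differ_by_const T \<and>
                  openin (cont_topology T) {f \<in> cont_funs T. mod_const T f \<in> W})"

lemma openin_cont_mod_const_topology:
  "openin (cont_mod_const_topology T) W \<longleftrightarrow>
     W \<subseteq> cont_funs T // differ_by_const T \<and>
     openin (cont_topology T) {f \<in> cont_funs T. mod_const T f \<in> W}"
proof -
  have "istopology (\<lambda>W. W \<subseteq> cont_funs T // differ_by_const T \<and>
                  openin (cont_topology T) {f \<in> cont_funs T. mod_const T f \<in> W})"
    unfolding istopology_def
  proof (intro conjI allI impI)
    fix S W
    assume "S \<subseteq> cont_funs T // differ_by_const T \<and>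
              openin (cont_topology T) {f \<in> cont_funs T. mod_const T f \<in> S}"
      and "W \<subseteq> cont_funs T // differ_by_const T \<and>
              openin (cont_topology T) {f \<in> cont_funs T. mod_const T f \<in> W}"
    moreover have "{f \<in> cont_funs T. mod_const T f \<in> S \<inter> W} =
        {f \<in> cont_funs T. mod_const T f \<in> S} \<inter> {f \<in> cont_funs T. mod_const T f \<in> W}"
      by auto
    ultimately show "S \<inter> W \<subseteq> cont_funs T // differ_by_const T"
      and "openin (cont_topology T) {f \<in> cont_funs T. mod_const T f \<in> S \<inter> W}"
      by (auto simp: openin_Int)
  next
    fix \<W>
    assume \<W>: "\<forall>W\<in>\<W>. W \<subseteq> cont_funs T // differ_by_const T \<and>
              openin (cont_topology T) {f \<in> cont_funs T. mod_const T f \<in> W}"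
    then show "\<Union>\<W> \<subseteq> cont_funs T // differ_by_const T"
      by blast
    have "{f \<in> cont_funs T. mod_const T f \<in> \<Union>\<W>} =
        (\<Union>W\<in>\<W>. {f \<in> cont_funs T. mod_const T f \<in> W})"
      by auto
    then show "openin (cont_topology T) {f \<in> cont_funs T. mod_const T f \<in> \<Union>\<W>}"
      using \<W> by (auto intro!: openin_clauses(3))
  qed
  then show ?thesis
    by (simp add: cont_mod_const_topology_def)
qed

lemma topspace_cont_mod_const_topology:
  "topspace (cont_mod_const_topology T) = cont_funs T // differ_by_const T"
proof -
  have "{f \<in> cont_funs T. mod_const T f \<in> cont_funs T // differ_by_const T} = cont_funs T"
    by (auto simp: mod_const_def quotientI)
  then have "openin (cont_mod_const_topology T) (cont_funs T // differ_by_const T)"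
    unfolding openin_cont_mod_const_topology by (metis openin_topspace order_refl topspace_cont_topology)
  moreover have "topspace (cont_mod_const_topology T) \<subseteq> cont_funs T // differ_by_const T"
    using openin_cont_mod_const_topology[of T "topspace (cont_mod_const_topology T)"] openin_topspace
    by blast
  ultimately show ?thesis
    by (intro subset_antisym[OF _ openin_subset])
qed

lemma quotient_map_mod_const:
  "quotient_map (cont_topology T) (cont_mod_const_topology T) (mod_const T)"
proof -
  have "mod_const T ` cont_funs T = cont_funs T // differ_by_const T"
    by (auto simp: mod_const_def quotient_def)
  then show ?thesis
    by (simp add: quotient_map_def topspace_cont_topology topspace_cont_mod_const_topology
        openin_cont_mod_const_topology)
qed

definition metric_embedding :: "'a topology \<Rightarrow> ('a \<Rightarrow> 'a \<Rightarrow> real) \<Rightarrow> 'a \<Rightarrow> ('a \<Rightarrow> real) set"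
  where "metric_embedding T d x = mod_const T (restrict (d x) (topspace T))"

definition metric_compactification :: "'a topology \<Rightarrow> ('a \<Rightarrow> 'a \<Rightarrow> real) \<Rightarrow> ('a \<Rightarrow> real) set topology"
  where "metric_compactification T d =
    subtopology (cont_mod_const_topology T)
      (cont_mod_const_topology T closure_of (metric_embedding T d ` topspace T))"

definition metric_boundary :: "'a topology \<Rightarrow> ('a \<Rightarrow> 'a \<Rightarrow> real) \<Rightarrow> ('a \<Rightarrow> real) set set"
  where "metric_boundary T d =
    topspace (metric_compactification T d) - metric_embedding T d ` topspace T"

definition horofunction :: "'a \<Rightarrow> ('a \<Rightarrow> real) set \<Rightarrow> 'a \<Rightarrow> real"
  where "horofunction p \<xi> = (THE h. h \<in> \<xi> \<and> h p = 0)"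

definition horoball :: "'a topology \<Rightarrow> 'a \<Rightarrow> ('a \<Rightarrow> real) set \<Rightarrow> real \<Rightarrow> 'a set"
  where "horoball T p \<xi> R = {z \<in> topspace T. horofunction p \<xi> z < 1/2 * ln R}"


section \<open>Big horospheres and horofunctions at boundary points\<close>

definition big_horosphere ::
  "'a topology \<Rightarrow> ('a set \<times> ('a \<Rightarrow> complex^'n::finite)) set \<Rightarrow> 'a set \<Rightarrow> (nat \<Rightarrow> 'a set) \<Rightarrow>
   'a \<Rightarrow> 'a + (nat \<Rightarrow> 'a set) \<Rightarrow> real \<Rightarrow> 'a set"
  where "big_horosphere X A \<Omega> K p x R =
    {z \<in> \<Omega>. Liminf (tending_to X \<Omega> K x)
               (\<lambda>w. ereal (kobayashi X A \<Omega> z w - kobayashi X A \<Omega> p w)) < ereal (1/2 * ln R)}"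

definition horofunctions_at ::
  "'a topology \<Rightarrow> ('a set \<times> ('a \<Rightarrow> complex^'n::finite)) set \<Rightarrow> 'a set \<Rightarrow> (nat \<Rightarrow> 'a set) \<Rightarrow>
   'a + (nat \<Rightarrow> 'a set) \<Rightarrow> ('a \<Rightarrow> real) set set"
  where "horofunctions_at X A \<Omega> K x =
    {\<xi> \<in> metric_boundary (subtopology X \<Omega>) (kobayashi X A \<Omega>).
       \<exists>\<sigma>::nat \<Rightarrow> 'a. range \<sigma> \<subseteq> \<Omega> \<and>
         limitin (end_compactification X \<Omega> K) (Inl \<circ> \<sigma>) x sequentially \<and>
         limitin (metric_compactification (subtopology X \<Omega>) (kobayashi X A \<Omega>))
           (metric_embedding (subtopology X \<Omega>) (kobayashi X A \<Omega>) \<circ> \<sigma>) \<xi> sequentially}"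

end

theory Submission
  imports Defs "HOL-Complex_Analysis.Riemann_Mapping"
begin

text \<open>The theorem is metric geometry once three facts about the Kobayashi distance \<open>d\<close> of \<open>\<Omega>\<close> are known.
  A chain of discs of nearly minimal length carries a connected set on which
  the triangle inequality for the end points is almost an equality (\<open>kobayashi_almost_geodesic\<close>): every
  disc may be normalised so that its marked points lie on a radius, which is a Poincare geodesic. As \<open>d\<close> is
  also continuous, by complex lines in charts, it induces the topology of \<open>\<Omega>\<close> (\<open>mtopology_kobayashi\<close>), and by the
  Hopf--Rinow argument completeness makes closed balls compact
  (\<open>compactin_mcball_if_almost_geodesic\<close>).

  Call a class \<open>\<xi>\<close> of the metric compactification and a point \<open>x\<close> of the end compactification related if
  arbitrarily small neighbourhoods of both contain a common point of \<open>\<Omega>\<close>; this is the closure of the diagonal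
  in the product. If \<open>x\<close> is a boundary point, two things happen. The horofunction of \<open>\<xi>\<close> is not bounded
  below, since one can walk from \<open>p\<close> along almost geodesics towards points \<open>w\<close> that escape to \<open>x\<close>
  (\<open>horofunction_unbounded_below\<close>); in particular \<open>\<xi>\<close> is not an embedded point. And the horoballs
  of \<open>\<xi>\<close> are contained in the big horospheres at \<open>x\<close> (\<open>horoball_subset_big_horosphere\<close>). Hence the closures of the horoballs
  intersect at most in \<open>x\<close>, and a limit of points in smaller and smaller horoballs shows that \<open>x\<close> belongs to
  all of them (\<open>Inter_closure_horoballs\<close>). This is the first assertion, because classes in \<open>horofunctions_at X A \<Omega> K x\<close> are
  related to \<open>x\<close>.

  It also shows that \<open>x\<close> is determined by \<open>\<xi>\<close>. So the relation is the graph of a map \<open>F\<close>, which is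
  defined everywhere because the end compactification is sequentially compact, is onto because the metric
  compactification is compact, and is continuous because its graph is closed. Working with
  the closed relation avoids choosing sequences in the end compactification, whose
  points need not have countable neighbourhood bases.\<close>


section \<open>Chains of holomorphic discs\<close>

text \<open>Radii of the unit disc are geodesics: the subtraction formula for \<open>artanh\<close> says
  that the Poincare distance is additive along \<open>[0, 1)\<close>.\<close>

lemma artanh_difference:
  fixes r s :: real
  assumes "0 \<le> s" "s \<le> r" "r < 1"
  shows "artanh ((r - s) / (1 - s * r)) = artanh r - artanh s"
proof -
  have sr: "s * r < 1"
    using assms by (metis less_eq_real_def linorder_not_less mult_le_one mult_left_le mult.commute order_trans order_less_le_trans)
  have "artanh ((r - s) / (1 - s * r)) = 1/2 * ln (((1 + r) * (1 - s)) / ((1 - r) * (1 + s)))"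
  proof -
    have "(1 + (r - s) / (1 - s * r)) / (1 - (r - s) / (1 - s * r))
        = (((1 - s * r) + (r - s)) / (1 - s * r)) / (((1 - s * r) - (r - s)) / (1 - s * r))"
      using sr by (simp add: add_divide_distrib diff_divide_distrib)
    also have "\<dots> = ((1 - s * r) + (r - s)) / ((1 - s * r) - (r - s))"
      using sr by simp
    also have "\<dots> = ((1 + r) * (1 - s)) / ((1 - r) * (1 + s))"
      by (rule arg_cong2[of _ _ _ _ "(/)"]) (simp_all add: algebra_simps)
    finally show ?thesis
      by (simp add: artanh_def)
  qed
  also have "\<dots> = artanh r - artanh s"
  proof -
    have "ln (((1 + r) * (1 - s)) / ((1 - r) * (1 + s))) = ln ((1 + r) / (1 - r)) - ln ((1 + s) / (1 - s))"
      using assms by (simp add: ln_div ln_mult_pos)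
    then show ?thesis
      by (simp add: artanh_def right_diff_distrib)
  qed
  finally show ?thesis .
qed

lemma poincare_dist_radial:
  assumes "0 \<le> s" "s \<le> r" "r < 1"
  shows "poincare_dist (of_real s) (of_real r) = artanh r - artanh s"
proof -
  have "cmod ((of_real s - of_real r) / (1 - cnj (of_real s) * of_real r)) = \<bar>(s - r) / (1 - s * r)\<bar>"
    by (metis complex_cnj_complex_of_real norm_of_real of_real_1 of_real_diff of_real_divide of_real_mult)
  also have "\<dots> = (r - s) / (1 - s * r)"
  proof -
    have "s * r \<le> 1" using assms by (simp add: mult_le_one)
    then show ?thesis using assms by (simp add: abs_divide)
  qed
  finally show ?thesis
    unfolding poincare_dist_def using artanh_difference[OF assms] by simp
qed

text \<open>Hence a Poincare distance is a value of \<open>artanh\<close> on \<open>[0, 1)\<close>, where this function is nonnegative.\<close>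

lemma pseudohyperbolic_less_1:
  assumes "a \<in> ball 0 1" "b \<in> ball 0 1"
  shows "cmod ((a - b) / (1 - cnj a * b)) < 1"
  using Moebius_function_norm_lt_1[of a b 0] assms
  by (simp add: Moebius_function_simple norm_divide norm_minus_commute)

lemma artanh_nonneg_real: "0 \<le> r \<Longrightarrow> r < 1 \<Longrightarrow> 0 \<le> artanh (r::real)"
  by (simp add: artanh_def)

lemma poincare_dist_nonneg:
  "a \<in> ball 0 1 \<Longrightarrow> b \<in> ball 0 1 \<Longrightarrow> 0 \<le> poincare_dist a b"
  unfolding poincare_dist_def
  by (intro artanh_nonneg_real pseudohyperbolic_less_1 norm_ge_zero)

text \<open>The automorphisms of the disc act transitively on pairs of points at a given distance. Precomposing
  with one of them puts the two marked points of a disc on a radius, where the geodesic is explicit.\<close>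

lemma disc_automorphism_normalising:
  assumes a: "a \<in> ball 0 1" and b: "b \<in> ball 0 1"
  obtains m r where "m holomorphic_on ball 0 1" "m ` ball 0 1 \<subseteq> ball 0 1"
    "0 \<le> r" "r < 1" "m 0 = a" "m (of_real r) = b" "artanh r = poincare_dist a b"
proof
  define q where "q = Moebius_function 0 a b"
  define u where "u = (if q = 0 then 1 else sgn q)"
  have u: "cmod u = 1" "u * of_real (cmod q) = q"
    by (auto simp: u_def norm_sgn) (simp add: sgn_eq)
  let ?m = "\<lambda>\<zeta>. Moebius_function 0 (- a) (u * \<zeta>)"
  have norm: "cmod (- a) < 1" using a by simp
  show "?m holomorphic_on ball 0 1"
    by (rule holomorphic_on_compose_gen[OF _ Moebius_function_holomorphic[OF norm], unfolded o_def])
       (auto intro!: holomorphic_intros simp: norm_mult u)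
  show "?m ` ball 0 1 \<subseteq> ball 0 1"
    using Moebius_function_norm_lt_1[OF norm] by (auto simp: norm_mult u simp del: norm_minus_cancel)
  show "0 \<le> cmod q" "cmod q < 1"
    using Moebius_function_norm_lt_1[of a b 0] a b by (auto simp: q_def)
  show "?m 0 = a"
    by (simp add: Moebius_function_simple)
  show "?m (of_real (cmod q)) = b"
    unfolding u(2) unfolding q_def
    by (rule Moebius_function_compose) (use a b in auto)
  show "artanh (cmod q) = poincare_dist a b"
    by (simp add: q_def poincare_dist_def Moebius_function_simple norm_divide norm_minus_commute)
qed

lemma holomorphic_disc_compose:
  assumes "holomorphic_disc X A \<Omega> f" "m holomorphic_on ball 0 1" "m ` ball 0 1 \<subseteq> ball 0 1"
  shows "holomorphic_disc X A \<Omega> (f \<circ> m)"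
  unfolding holomorphic_disc_def
proof (intro conjI allI ballI, goal_cases)
  case 1
  have "continuous_map (top_of_set (ball 0 1)) (top_of_set (ball 0 1)) m"
    using assms(2,3) holomorphic_on_imp_continuous_on by auto
  then show ?case
    using assms(1) continuous_map_compose unfolding holomorphic_disc_def by blast
next
  case 2
  then show ?case using assms by (auto simp: holomorphic_disc_def)
next
  case (3 U\<phi>)
  obtain U \<phi> where U: "U\<phi> = (U, \<phi>)" by force
  have "(\<lambda>\<zeta>. \<phi> (f \<zeta>) $ i) holomorphic_on {\<zeta> \<in> ball 0 1. f \<zeta> \<in> U}" for i
    using assms(1) 3 by (auto simp: holomorphic_disc_def U)
  then have "((\<lambda>\<zeta>. \<phi> (f \<zeta>) $ i) \<circ> m) holomorphic_on {\<zeta> \<in> ball 0 1. (f \<circ> m) \<zeta> \<in> U}" for i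
    by (rule holomorphic_on_compose_gen[rotated])
       (use assms(2,3) in \<open>auto elim!: holomorphic_on_subset simp: image_subset_iff\<close>)
  then show ?case by (simp add: U o_def)
qed

lemma holomorphic_disc_in: "holomorphic_disc X A \<Omega> f \<Longrightarrow> a \<in> ball 0 1 \<Longrightarrow> f a \<in> \<Omega>"
  by (auto simp: holomorphic_disc_def)

text \<open>Without a lower bound the infimum that defines the Kobayashi distance would be an unspecified
  number; this lemma makes it usable.\<close>

lemma kobayashi_lengths_bounded_below:
  "bdd_below {\<Sum>i<n. poincare_dist (a i) (b i) | (n::nat) f a b q.
      q 0 = x \<and> q n = y \<and>
      (\<forall>i<n. holomorphic_disc X A \<Omega> (f i) \<and> a i \<in> ball 0 1 \<and> b i \<in> ball 0 1 \<and>
             f i (a i) = q i \<and> f i (b i) = q (Suc i))}"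
  by (rule bdd_belowI[of _ 0]) (auto intro!: sum_nonneg poincare_dist_nonneg)

text \<open>A single disc is a chain of length one, so holomorphic discs do not increase distances.\<close>

lemma kobayashi_le_poincare_dist:
  assumes "holomorphic_disc X A \<Omega> f" "a \<in> ball 0 1" "b \<in> ball 0 1"
  shows "kobayashi X A \<Omega> (f a) (f b) \<le> poincare_dist a b"
proof -
  define q where "q = (\<lambda>i::nat. if i = 0 then f a else f b)"
  have "\<exists>(n::nat) g c e q'. poincare_dist a b = (\<Sum>i<n. poincare_dist (c i) (e i)) \<and>
          q' 0 = f a \<and> q' n = f b \<and>
          (\<forall>i<n. holomorphic_disc X A \<Omega> (g i) \<and> c i \<in> ball 0 1 \<and> e i \<in> ball 0 1 \<and>
             g i (c i) = q' i \<and> g i (e i) = q' (Suc i))"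
    using assms
    by (intro exI[of _ 1] exI[of _ "\<lambda>_. f"] exI[of _ "\<lambda>_. a"] exI[of _ "\<lambda>_. b"] exI[of _ q])
       (auto simp: q_def)
  then have "Inf {\<Sum>i<n. poincare_dist (c i) (e i) | (n::nat) g c e q.
      q 0 = f a \<and> q n = f b \<and>
      (\<forall>i<n. holomorphic_disc X A \<Omega> (g i) \<and> c i \<in> ball 0 1 \<and> e i \<in> ball 0 1 \<and>
             g i (c i) = q i \<and> g i (e i) = q (Suc i))} \<le> poincare_dist a b"
    by (intro cInf_lower[OF CollectI kobayashi_lengths_bounded_below])
  then show ?thesis
    using assms by (simp add: kobayashi_def holomorphic_disc_in)
qed

text \<open>The image of a radius is connected, and its points lie between the two ends as far as the
  length contributed by the disc can tell, because the Poincare distance is additive on the radius and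
  does not increase under the disc.\<close>

lemma connected_in_disc:
  assumes met: "Metric_space \<Omega> (kobayashi X A \<Omega>)"
    and f: "holomorphic_disc X A \<Omega> f" and a: "a \<in> ball 0 1" and b: "b \<in> ball 0 1"
  obtains C where "connectedin X C" "C \<subseteq> \<Omega>" "f a \<in> C" "f b \<in> C"
    "\<And>z. z \<in> C \<Longrightarrow> kobayashi X A \<Omega> (f a) z + kobayashi X A \<Omega> z (f b) \<le> poincare_dist a b"
proof -
  obtain m r where m: "m holomorphic_on ball 0 1" "m ` ball 0 1 \<subseteq> ball 0 1"
    "0 \<le> r" "r < 1" "m 0 = a" "m (of_real r) = b" "artanh r = poincare_dist a b"
    using disc_automorphism_normalising[OF a b] .
  define g where "g = f \<circ> m"
  have g: "holomorphic_disc X A \<Omega> g"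
    unfolding g_def using f m(1,2) by (rule holomorphic_disc_compose)
  have g0: "g 0 = f a" and gr: "g (of_real r) = f b"
    using m by (auto simp: g_def)
  show ?thesis
  proof
    show "connectedin X (g ` of_real ` {0..r})"
    proof (rule connectedin_continuous_map_image)
      show "continuous_map (top_of_set (ball 0 1)) X g"
        using g by (simp add: holomorphic_disc_def)
      have "connected ((of_real :: real \<Rightarrow> complex) ` {0..r})"
        by (intro connected_continuous_image continuous_intros connected_Icc)
      then show "connectedin (top_of_set (ball 0 1)) ((of_real :: real \<Rightarrow> complex) ` {0..r})"
        using m by (auto simp: connectedin_subtopology)
    qed
    show "g ` of_real ` {0..r} \<subseteq> \<Omega>"
      using holomorphic_disc_in[OF g] m by auto
    show "f a \<in> g ` of_real ` {0..r}" using g0 m(3)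
      by (metis atLeastAtMost_iff imageI of_real_0 order_refl)
    show "f b \<in> g ` of_real ` {0..r}" using gr m(3)
      by (metis atLeastAtMost_iff imageI order_refl)
    fix z assume "z \<in> g ` of_real ` {0..r}"
    then obtain s where s: "0 \<le> s" "s \<le> r" "z = g (of_real s)" by auto
    have "kobayashi X A \<Omega> (g (of_real 0)) z \<le> artanh s - artanh 0"
      unfolding s(3) using s m by (subst poincare_dist_radial[symmetric]) (auto intro!: kobayashi_le_poincare_dist[OF g])
    moreover have "kobayashi X A \<Omega> z (g (of_real r)) \<le> artanh r - artanh s"
      unfolding s(3) using s m by (subst poincare_dist_radial[symmetric]) (auto intro!: kobayashi_le_poincare_dist[OF g])
    ultimately show "kobayashi X A \<Omega> (f a) z + kobayashi X A \<Omega> z (f b) \<le> poincare_dist a b"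
      using m g0 gr by simp
  qed
qed

text \<open>Gluing the images of the radii along a chain: a point on one link pays the full length of the
  other links by the triangle inequality, so the bound by the total length survives.\<close>

lemma connected_along_chain:
  assumes met: "Metric_space \<Omega> (kobayashi X A \<Omega>)" and X: "\<Omega> \<subseteq> topspace X" and q0: "q 0 \<in> \<Omega>"
    and chain: "\<And>i. i < n \<Longrightarrow> holomorphic_disc X A \<Omega> (f i) \<and> a i \<in> ball 0 1 \<and> b i \<in> ball 0 1 \<and>
             f i (a i) = q i \<and> f i (b i) = q (Suc i)"
  shows "\<exists>C. connectedin X C \<and> C \<subseteq> \<Omega> \<and> q 0 \<in> C \<and> q n \<in> C \<and>
    (\<forall>z\<in>C. kobayashi X A \<Omega> (q 0) z + kobayashi X A \<Omega> z (q n) \<le> (\<Sum>i<n. poincare_dist (a i) (b i)))"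
  using chain
proof (induction n)
  case 0
  then show ?case
    using q0 X by (intro exI[of _ "{q 0}"]) (auto simp: Metric_space.mdist_zero[OF met])
next
  case (Suc n)
  interpret Metric_space \<Omega> "kobayashi X A \<Omega>" by (rule met)
  obtain C where C: "connectedin X C" "C \<subseteq> \<Omega>" "q 0 \<in> C" "q n \<in> C"
    "\<And>z. z \<in> C \<Longrightarrow> kobayashi X A \<Omega> (q 0) z + kobayashi X A \<Omega> z (q n) \<le> (\<Sum>i<n. poincare_dist (a i) (b i))"
    using Suc by auto
  have fn: "holomorphic_disc X A \<Omega> (f n)" "a n \<in> ball 0 1" "b n \<in> ball 0 1"
      "f n (a n) = q n" "f n (b n) = q (Suc n)"
    using Suc.prems[of n] by auto
  obtain D where D: "connectedin X D" "D \<subseteq> \<Omega>" "q n \<in> D" "q (Suc n) \<in> D"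
    "\<And>z. z \<in> D \<Longrightarrow> kobayashi X A \<Omega> (q n) z + kobayashi X A \<Omega> z (q (Suc n)) \<le> poincare_dist (a n) (b n)"
    using connected_in_disc[OF met fn(1-3)] fn(4,5) by metis
  have cn: "kobayashi X A \<Omega> (q 0) (q n) \<le> (\<Sum>i<n. poincare_dist (a i) (b i))"
    using C(5)[OF C(4)] mdist_zero[of "q n"] C(2,4) by auto
  have dn: "kobayashi X A \<Omega> (q n) (q (Suc n)) \<le> poincare_dist (a n) (b n)"
    using D(5)[OF D(3)] mdist_zero[of "q n"] D(2,3) by auto
  show ?case
  proof (intro exI[of _ "C \<union> D"] conjI ballI)
    show "connectedin X (C \<union> D)"
      using C D by (intro connectedin_Un) auto
    fix z assume "z \<in> C \<union> D"
    then show "kobayashi X A \<Omega> (q 0) z + kobayashi X A \<Omega> z (q (Suc n)) \<le> (\<Sum>i<Suc n. poincare_dist (a i) (b i))"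
    proof
      assume z: "z \<in> C"
      then have "kobayashi X A \<Omega> z (q (Suc n)) \<le> kobayashi X A \<Omega> z (q n) + kobayashi X A \<Omega> (q n) (q (Suc n))"
        using C D by (intro triangle) auto
      then show ?thesis using C(5)[OF z] dn by simp
    next
      assume z: "z \<in> D"
      then have "kobayashi X A \<Omega> (q 0) z \<le> kobayashi X A \<Omega> (q 0) (q n) + kobayashi X A \<Omega> (q n) z"
        using C D by (intro triangle) auto
      then show ?thesis using D(5)[OF z] cn by simp
    qed
  qed (use C D in auto)
qed

section \<open>Holomorphic discs in charts\<close>

lemma norm_complex_vector_scale: "norm (c *s (v :: complex^'n)) = cmod c * norm v"
  by (simp add: norm_vec_def norm_mult L2_set_right_distrib)

lemma complex_manifoldD:
  assumes "complex_manifold X A" "(U, \<phi>) \<in> A"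
  shows "openin X U" "open (\<phi> ` U)" "homeomorphic_map (subtopology X U) (top_of_set (\<phi> ` U)) \<phi>"
    "inj_on \<phi> U" "U \<subseteq> topspace X"
    "continuous_map (top_of_set (\<phi> ` U)) X (inv_into U \<phi>)"
proof -
  show U: "openin X U" and "open (\<phi> ` U)"
    and hom: "homeomorphic_map (subtopology X U) (top_of_set (\<phi> ` U)) \<phi>"
    using assms unfolding complex_manifold_def by blast+
  show sub: "U \<subseteq> topspace X" using U openin_subset by blast
  show inj: "inj_on \<phi> U"
    using homeomorphic_imp_injective_map[OF hom] sub by (simp add: Int_absorb1)
  obtain g where g: "homeomorphic_maps (subtopology X U) (top_of_set (\<phi> ` U)) \<phi> g"
    using hom homeomorphic_map_maps by blast
  then have "g y = inv_into U \<phi> y" if "y \<in> \<phi> ` U" for y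
    using that inj sub by (auto simp: homeomorphic_maps_def)
  moreover have "continuous_map (top_of_set (\<phi> ` U)) X g"
    using g continuous_map_in_subtopology unfolding homeomorphic_maps_def by blast
  ultimately show "continuous_map (top_of_set (\<phi> ` U)) X (inv_into U \<phi>)"
    by (auto elim: continuous_map_eq)
qed

text \<open>The transition maps have complex linear derivatives, so a complex line in one chart is
  holomorphic when read in every other chart.\<close>

lemma holomorphic_disc_in_chart:
  fixes v :: "complex^'n::finite"
  assumes mf: "complex_manifold X A" and U: "(U, \<phi>) \<in> A"
    and sub: "\<And>\<zeta>. \<zeta> \<in> ball 0 1 \<Longrightarrow> c + \<zeta> *s v \<in> \<phi> ` (U \<inter> \<Omega>)"
  shows "holomorphic_disc X A \<Omega> (\<lambda>\<zeta>. inv_into U \<phi> (c + \<zeta> *s v))"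
  unfolding holomorphic_disc_def
proof (intro conjI)
  note chart = complex_manifoldD[OF mf U]
  have lin: "((\<lambda>\<zeta>. c + \<zeta> *s v) has_derivative (\<lambda>h. h *s v)) (at \<zeta> within S)" for \<zeta> S
  proof -
    have "bounded_linear (\<lambda>h. h *s v)"
      by (rule bounded_linear_intro[of _ "norm v"])
         (auto simp: vec_eq_iff algebra_simps norm_complex_vector_scale)
    then have "((\<lambda>\<zeta>. \<zeta> *s v) has_derivative (\<lambda>h. h *s v)) (at \<zeta> within S)"
      by (rule bounded_linear_imp_has_derivative)
    from has_derivative_add[OF has_derivative_const[of c] this] show ?thesis by simp
  qed
  have "continuous_on (ball 0 1) (\<lambda>\<zeta>. c + \<zeta> *s v)"
    unfolding continuous_on_eq_continuous_within
    using has_derivative_continuous[OF lin] by blast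
  then have "continuous_map (top_of_set (ball 0 1)) (top_of_set (\<phi> ` U)) (\<lambda>\<zeta>. c + \<zeta> *s v)"
    using sub by (fastforce simp: continuous_map_in_subtopology)
  from continuous_map_compose[OF this chart(6)]
  show "continuous_map (top_of_set (ball 0 1)) X (\<lambda>\<zeta>. inv_into U \<phi> (c + \<zeta> *s v))"
    by (simp add: o_def)
  have inv: "inv_into U \<phi> y \<in> U \<inter> \<Omega>" "\<phi> (inv_into U \<phi> y) = y" if "y \<in> \<phi> ` (U \<inter> \<Omega>)" for y
    using that chart(4) by (auto simp: inv_into_f_f)
  show "(\<lambda>\<zeta>. inv_into U \<phi> (c + \<zeta> *s v)) ` ball 0 1 \<subseteq> \<Omega>"
    using inv(1)[OF sub] by auto
  show "\<forall>(V, \<psi>)\<in>A. \<forall>i. (\<lambda>\<zeta>. \<psi> (inv_into U \<phi> (c + \<zeta> *s v)) $ i) holomorphic_on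
      {\<zeta> \<in> ball 0 1. inv_into U \<phi> (c + \<zeta> *s v) \<in> V}"
  proof (clarify)
    fix V \<psi> i assume V: "(V, \<psi>) \<in> A"
    have trans: "holomorphic_map_on (\<psi> \<circ> inv_into U \<phi>) (\<phi> ` (U \<inter> V))"
      using mf U V unfolding complex_manifold_def by blast
    let ?S = "{\<zeta> \<in> ball 0 1. inv_into U \<phi> (c + \<zeta> *s v) \<in> V}"
    show "(\<lambda>\<zeta>. \<psi> (inv_into U \<phi> (c + \<zeta> *s v)) $ i) holomorphic_on ?S"
      unfolding holomorphic_on_def
    proof
      fix \<zeta> assume \<zeta>: "\<zeta> \<in> ?S"
      then have "c + \<zeta> *s v \<in> \<phi> ` (U \<inter> V)"
        using inv[OF sub[of \<zeta>]] by (metis (mono_tags, lifting) IntD1 IntI imageI mem_Collect_eq)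
      then obtain D where D: "((\<psi> \<circ> inv_into U \<phi>) has_derivative D) (at (c + \<zeta> *s v))"
        "\<And>a w. D (a *s w) = a *s D w"
        using trans unfolding holomorphic_map_on_def by blast
      have "((\<psi> \<circ> inv_into U \<phi>) \<circ> (\<lambda>\<zeta>. c + \<zeta> *s v) has_derivative D \<circ> (\<lambda>h. h *s v)) (at \<zeta> within ?S)"
        by (rule diff_chain_within[OF lin has_derivative_at_withinI[OF D(1)]])
      then have "((\<lambda>\<zeta>. \<psi> (inv_into U \<phi> (c + \<zeta> *s v))) has_derivative (\<lambda>h. h *s D v)) (at \<zeta> within ?S)"
        by (simp add: o_def D(2))
      from bounded_linear.has_derivative[OF bounded_linear_vec_nth[of i] this]
      have "((\<lambda>\<zeta>. \<psi> (inv_into U \<phi> (c + \<zeta> *s v)) $ i) has_derivative (\<lambda>h. h * (D v $ i))) (at \<zeta> within ?S)"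
        by simp
      then have "((\<lambda>\<zeta>. \<psi> (inv_into U \<phi> (c + \<zeta> *s v)) $ i) has_field_derivative (D v $ i)) (at \<zeta> within ?S)"
        by (simp add: has_field_derivative_def mult.commute[of "D v $ i"] mult_commute_abs)
      then show "(\<lambda>\<zeta>. \<psi> (inv_into U \<phi> (c + \<zeta> *s v)) $ i) field_differentiable at \<zeta> within ?S"
        unfolding field_differentiable_def by blast
    qed
  qed
qed

lemma chart_ball:
  assumes mf: "complex_manifold X (A :: ('a set \<times> ('a \<Rightarrow> complex^'n::finite)) set)"
    and W: "openin X W" and x: "x \<in> W"
  obtains U \<phi> \<rho> where "(U, \<phi>) \<in> A" "x \<in> U" "0 < \<rho>" "ball (\<phi> x) \<rho> \<subseteq> \<phi> ` (U \<inter> W)"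
proof -
  have "x \<in> topspace X" using W x openin_subset by blast
  then obtain U \<phi> where U: "(U, \<phi>) \<in> A" "x \<in> U"
    using mf unfolding complex_manifold_def by blast
  note chart = complex_manifoldD[OF mf U(1)]
  have "openin (top_of_set (\<phi> ` U)) (\<phi> ` (U \<inter> W))"
  proof (rule homeomorphic_imp_open_map[OF chart(3), unfolded open_map_def, rule_format])
    show "openin (subtopology X U) (U \<inter> W)"
      using W openin_subtopology_Int2 by blast
  qed
  then have "open (\<phi> ` (U \<inter> W))"
    using chart(2) openin_open_eq by blast
  moreover have "\<phi> x \<in> \<phi> ` (U \<inter> W)" using U x by blast
  ultimately obtain \<rho> where "0 < \<rho>" "ball (\<phi> x) \<rho> \<subseteq> \<phi> ` (U \<inter> W)"
    unfolding open_contains_ball by blast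
  then show ?thesis using that U by blast
qed

lemma openin_chart_ball:
  assumes mf: "complex_manifold X A" and U: "(U, \<phi>) \<in> A"
  shows "openin X {y \<in> U. \<phi> y \<in> ball c \<rho>}"
proof -
  note chart = complex_manifoldD[OF mf U]
  have "continuous_map (subtopology X U) euclidean \<phi>"
    using chart(3) homeomorphic_imp_continuous_map continuous_map_in_subtopology by blast
  then have "openin (subtopology X U) {y \<in> topspace (subtopology X U). \<phi> y \<in> ball c \<rho>}"
    by (intro openin_continuous_map_preimage) auto
  then have "openin (subtopology X U) {y \<in> U. \<phi> y \<in> ball c \<rho>}"
    using chart(5) by (simp add: Int_absorb1)
  then show ?thesis
    using chart(1) openin_trans_full by blast
qed

text \<open>Two nearby points of a chart lie on a complex line, so they are joined by a single disc.\<close>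

lemma nearby_points_on_disc:
  assumes mf: "complex_manifold X (A :: ('a set \<times> ('a \<Rightarrow> complex^'n::finite)) set)"
    and \<Omega>: "openin X \<Omega>" and x: "x \<in> \<Omega>" and \<epsilon>: "0 < (\<epsilon>::real)"
  shows "\<exists>N. openin X N \<and> x \<in> N \<and> N \<subseteq> \<Omega> \<and>
    (\<forall>y\<in>N. \<exists>f b. holomorphic_disc X A \<Omega> f \<and> b \<in> ball 0 1 \<and> f 0 = x \<and> f b = y \<and>
        poincare_dist 0 b < \<epsilon>)"
proof -
  obtain U \<phi> \<rho> where U: "(U, \<phi>) \<in> A" "x \<in> U" and \<rho>: "0 < \<rho>" "ball (\<phi> x) \<rho> \<subseteq> \<phi> ` (U \<inter> \<Omega>)"
    using chart_ball[OF mf \<Omega> x] .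
  note chart = complex_manifoldD[OF mf U(1)]
  have "isCont artanh (0::real)" by (intro isCont_artanh) auto
  then obtain \<delta> where \<delta>: "0 < \<delta>" "\<And>t. \<bar>t\<bar> < \<delta> \<Longrightarrow> \<bar>artanh t\<bar> < \<epsilon>"
    using \<epsilon> unfolding continuous_at_eps_delta by (auto simp: dist_real_def)
  let ?N = "{y \<in> U. \<phi> y \<in> ball (\<phi> x) (\<rho> * min 1 \<delta>)}"
  have le: "\<rho> * min 1 \<delta> \<le> \<rho>" using \<rho>(1) by (simp add: mult_le_cancel_left1)
  show ?thesis
  proof (intro exI[of _ ?N] conjI ballI)
    show "openin X ?N" by (rule openin_chart_ball[OF mf U(1)])
    show "x \<in> ?N" using U \<rho> \<delta> by simp
    show "?N \<subseteq> \<Omega>"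
    proof
      fix y assume y: "y \<in> ?N"
      then have "\<phi> y \<in> \<phi> ` (U \<inter> \<Omega>)" using \<rho>(2) le by fastforce
      then show "y \<in> \<Omega>" using y chart(4) by (auto simp: inj_on_def)
    qed
    fix y assume y: "y \<in> ?N"
    define w where "w = \<phi> y - \<phi> x"
    \<comment> \<open>The direction is scaled so that the unit disc fills the line inside the ball of radius \<open>\<rho>\<close>.
      For \<open>w = 0\<close> division by zero makes \<open>v = 0\<close>, and the disc is constant.\<close>
    define v where "v = (\<rho> / norm w) *\<^sub>R w"
    define b where "b = complex_of_real (norm w / \<rho>)"
    have w: "norm w < \<rho> * min 1 \<delta>" using y by (simp add: w_def dist_norm norm_minus_commute)
    then have w1: "norm w / \<rho> < min 1 \<delta>"
      using \<rho>(1) by (subst pos_divide_less_eq) (simp_all only: mult.commute)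
    have nv: "norm v \<le> \<rho>" using \<rho>(1) by (simp add: v_def)
    have "\<phi> x + \<zeta> *s v \<in> \<phi> ` (U \<inter> \<Omega>)" if "\<zeta> \<in> ball 0 1" for \<zeta>
    proof -
      have "norm (\<zeta> *s v) < \<rho>"
        unfolding norm_complex_vector_scale
        using that \<rho>(1) mult_left_mono[OF nv norm_ge_zero[of \<zeta>]] mult_strict_right_mono[of "cmod \<zeta>" 1 \<rho>]
        by (simp add: order.strict_trans1)
      then show ?thesis using \<rho>(2) by (auto simp: dist_norm)
    qed
    then have disc: "holomorphic_disc X A \<Omega> (\<lambda>\<zeta>. inv_into U \<phi> (\<phi> x + \<zeta> *s v))"
      by (rule holomorphic_disc_in_chart[OF mf U(1)])
    have "b *s v = w"
    proof (cases "w = 0")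
      case False
      have "b *s v = (norm w / \<rho>) *\<^sub>R v"
        by (simp add: b_def vec_eq_iff complex_eq_iff)
      then show ?thesis using False \<rho>(1) by (simp add: v_def)
    qed (simp add: b_def v_def vec_eq_iff)
    then have fb: "inv_into U \<phi> (\<phi> x + b *s v) = y"
      using y chart(4) by (simp add: w_def inv_into_f_f)
    have f0: "inv_into U \<phi> (\<phi> x + 0 *s v) = x"
      using U chart(4) by (simp add: inv_into_f_f)
    have "poincare_dist 0 b = artanh (norm w / \<rho>)"
      using \<rho>(1) by (simp add: poincare_dist_def b_def norm_divide)
    then have "poincare_dist 0 b < \<epsilon>" using \<delta>(2)[of "norm w / \<rho>"] w1 \<rho>(1) by auto
    moreover have "b \<in> ball 0 1" using w1 \<rho>(1) by (simp add: b_def norm_divide)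
    ultimately show "\<exists>f b. holomorphic_disc X A \<Omega> f \<and> b \<in> ball 0 1 \<and> f 0 = x \<and> f b = y \<and>
        poincare_dist 0 b < \<epsilon>"
      using disc f0 fb by (intro exI[of _ "\<lambda>\<zeta>. inv_into U \<phi> (\<phi> x + \<zeta> *s v)"] exI[of _ b]) simp
  qed
qed

lemma kobayashi_small_near_point:
  assumes mf: "complex_manifold X (A :: ('a set \<times> ('a \<Rightarrow> complex^'n::finite)) set)"
    and \<Omega>: "openin X \<Omega>" and x: "x \<in> \<Omega>" and \<epsilon>: "0 < \<epsilon>"
  obtains N where "openin X N" "x \<in> N" "N \<subseteq> \<Omega>" "\<And>y. y \<in> N \<Longrightarrow> kobayashi X A \<Omega> x y < \<epsilon>"
proof -
  obtain N where N: "openin X N" "x \<in> N" "N \<subseteq> \<Omega>"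
    "\<forall>y\<in>N. \<exists>f b. holomorphic_disc X A \<Omega> f \<and> b \<in> ball 0 1 \<and> f 0 = x \<and> f b = y \<and>
        poincare_dist 0 b < \<epsilon>"
    using nearby_points_on_disc[OF mf \<Omega> x \<epsilon>] by (elim exE conjE)
  have "kobayashi X A \<Omega> x y < \<epsilon>" if y: "y \<in> N" for y
  proof -
    obtain f b where f: "holomorphic_disc X A \<Omega> f" "b \<in> ball 0 1" "f 0 = x" "f b = y" "poincare_dist 0 b < \<epsilon>"
      using bspec[OF N(4) y] by (elim exE conjE)
    then show ?thesis using kobayashi_le_poincare_dist[OF f(1), of 0 b] by simp
  qed
  with N that show ?thesis by blast
qed

text \<open>The points that chains of discs reach from a given point form an open set, and so do the
  others, because nearby points are joined by a single disc; a domain is connected. Without such a chain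
  the Kobayashi distance would be the infimum of the empty set.\<close>

lemma disc_chain_exists:
  assumes mf: "complex_manifold X (A :: ('a set \<times> ('a \<Rightarrow> complex^'n::finite)) set)"
    and dom: "domain_in X \<Omega>" and x: "x \<in> \<Omega>" and y: "y \<in> \<Omega>"
  shows "\<exists>(n::nat) f a b q. q 0 = x \<and> q n = y \<and>
    (\<forall>i<n. holomorphic_disc X A \<Omega> (f i) \<and> a i \<in> ball 0 1 \<and> b i \<in> ball 0 1 \<and>
             f i (a i) = q i \<and> f i (b i) = q (Suc i))"
proof -
  define R where "R = {(u, v). \<exists>f a b. holomorphic_disc X A \<Omega> f \<and> a \<in> ball 0 1 \<and> b \<in> ball 0 1 \<and>
      f a = u \<and> f b = v}"
  have \<Omega>: "openin X \<Omega>" and conn: "connectedin X \<Omega>" using dom by (auto simp: domain_in_def)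
  have near: "\<exists>N. openin X N \<and> u \<in> N \<and> N \<subseteq> \<Omega> \<and> (\<forall>v\<in>N. (u, v) \<in> R \<and> (v, u) \<in> R)" if u: "u \<in> \<Omega>" for u
  proof -
    obtain N where N: "openin X N" "u \<in> N" "N \<subseteq> \<Omega>"
      "\<forall>y\<in>N. \<exists>f b. holomorphic_disc X A \<Omega> f \<and> b \<in> ball 0 1 \<and> f 0 = u \<and> f b = y \<and>
          poincare_dist 0 b < 1"
      using nearby_points_on_disc[OF mf \<Omega> u zero_less_one] by (elim exE conjE)
    have "(u, v) \<in> R \<and> (v, u) \<in> R" if v: "v \<in> N" for v
      proof -
      obtain f b where "holomorphic_disc X A \<Omega> f" "b \<in> ball 0 1" "f 0 = u" "f b = v"
        using bspec[OF N(4) v] by (elim exE conjE)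
      moreover have "(0::complex) \<in> ball 0 1" by simp
      ultimately show ?thesis unfolding R_def by blast
    qed
    with N show ?thesis by blast
  qed
  have reached: "openin X {v \<in> \<Omega>. (x, v) \<in> R\<^sup>*}"
  proof (subst openin_subopen, clarify)
    fix v assume v: "v \<in> \<Omega>" "(x, v) \<in> R\<^sup>*"
    obtain N where "openin X N" "v \<in> N" "N \<subseteq> \<Omega>" "\<forall>w\<in>N. (v, w) \<in> R" using near[OF v(1)] by blast
    then show "\<exists>T. openin X T \<and> v \<in> T \<and> T \<subseteq> {v \<in> \<Omega>. (x, v) \<in> R\<^sup>*}"
      using v(2) by (intro exI[of _ N]) (auto intro: rtrancl_into_rtrancl)
  qed
  have unreached: "openin X {v \<in> \<Omega>. (x, v) \<notin> R\<^sup>*}"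
  proof (subst openin_subopen, clarify)
    fix v assume v: "v \<in> \<Omega>" "(x, v) \<notin> R\<^sup>*"
    obtain N where "openin X N" "v \<in> N" "N \<subseteq> \<Omega>" "\<forall>w\<in>N. (w, v) \<in> R" using near[OF v(1)] by blast
    then show "\<exists>T. openin X T \<and> v \<in> T \<and> T \<subseteq> {v \<in> \<Omega>. (x, v) \<notin> R\<^sup>*}"
      using v(2) by (intro exI[of _ N]) (auto intro: rtrancl_into_rtrancl)
  qed
  have "{v \<in> \<Omega>. (x, v) \<notin> R\<^sup>*} \<inter> \<Omega> = {}"
  proof (rule ccontr)
    assume "{v \<in> \<Omega>. (x, v) \<notin> R\<^sup>*} \<inter> \<Omega> \<noteq> {}"
    moreover have "\<Omega> \<subseteq> {v \<in> \<Omega>. (x, v) \<in> R\<^sup>*} \<union> {v \<in> \<Omega>. (x, v) \<notin> R\<^sup>*}" by blast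
    moreover have "{v \<in> \<Omega>. (x, v) \<in> R\<^sup>*} \<inter> {v \<in> \<Omega>. (x, v) \<notin> R\<^sup>*} \<inter> \<Omega> = {}" by blast
    moreover have "{v \<in> \<Omega>. (x, v) \<in> R\<^sup>*} \<inter> \<Omega> \<noteq> {}" using x by blast
    ultimately show False
      using connectedinD[OF conn reached unreached] by simp
  qed
  then have "(x, y) \<in> R\<^sup>*" using y by blast
  then obtain n where "(x, y) \<in> R ^^ n" using rtrancl_imp_relpow by blast
  then obtain q where q: "q 0 = x" "q n = y" "\<And>i. i < n \<Longrightarrow> (q i, q (Suc i)) \<in> R"
    unfolding relpow_fun_conv by blast
  have "\<forall>i. \<exists>f a b. i < n \<longrightarrow> holomorphic_disc X A \<Omega> f \<and> a \<in> ball 0 1 \<and> b \<in> ball 0 1 \<and>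
             f a = q i \<and> f b = q (Suc i)"
  proof
    fix i
    show "\<exists>f a b. i < n \<longrightarrow> holomorphic_disc X A \<Omega> f \<and> a \<in> ball 0 1 \<and> b \<in> ball 0 1 \<and>
             f a = q i \<and> f b = q (Suc i)"
      using q(3)[of i] by (cases "i < n") (simp_all only: R_def mem_Collect_eq prod.case simp_thms)
  qed
  then obtain f a b where fab: "\<And>i. i < n \<Longrightarrow> holomorphic_disc X A \<Omega> (f i) \<and> a i \<in> ball 0 1 \<and> b i \<in> ball 0 1 \<and>
             f i (a i) = q i \<and> f i (b i) = q (Suc i)"
    by metis
  show ?thesis
    by (intro exI[of _ n] exI[of _ f] exI[of _ a] exI[of _ b] exI[of _ q] conjI allI impI q(1,2) fab) assumption
qed

text \<open>The substitute for geodesics: chains of nearly minimal length carry connected sets on which the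
  triangle inequality is almost an equality.\<close>

lemma kobayashi_almost_geodesic:
  assumes mf: "complex_manifold X (A :: ('a set \<times> ('a \<Rightarrow> complex^'n::finite)) set)"
    and dom: "domain_in X \<Omega>" and met: "Metric_space \<Omega> (kobayashi X A \<Omega>)"
    and x: "x \<in> \<Omega>" and y: "y \<in> \<Omega>" and \<epsilon>: "0 < \<epsilon>"
  shows "\<exists>C. connectedin X C \<and> C \<subseteq> \<Omega> \<and> x \<in> C \<and> y \<in> C \<and>
    (\<forall>z\<in>C. kobayashi X A \<Omega> x z + kobayashi X A \<Omega> z y < kobayashi X A \<Omega> x y + \<epsilon>)"
proof -
  let ?L = "{\<Sum>i<n. poincare_dist (a i) (b i) | (n::nat) f a b q.
      q 0 = x \<and> q n = y \<and>
      (\<forall>i<n. holomorphic_disc X A \<Omega> (f i) \<and> a i \<in> ball 0 1 \<and> b i \<in> ball 0 1 \<and>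
             f i (a i) = q i \<and> f i (b i) = q (Suc i))}"
  have "?L \<noteq> {}"
  proof -
    obtain n :: nat and f a b q where "q 0 = x \<and> q n = y \<and>
        (\<forall>i<n. holomorphic_disc X A \<Omega> (f i) \<and> a i \<in> ball 0 1 \<and> b i \<in> ball 0 1 \<and>
             f i (a i) = q i \<and> f i (b i) = q (Suc i))"
      using disc_chain_exists[OF mf dom x y] by (elim exE)
    then have "(\<Sum>i<n. poincare_dist (a i) (b i)) \<in> ?L" by blast
    then show ?thesis by blast
  qed
  moreover have "Inf ?L < kobayashi X A \<Omega> x y + \<epsilon>"
    using x y \<epsilon> by (simp add: kobayashi_def)
  ultimately obtain l where "l \<in> ?L" and l: "l < kobayashi X A \<Omega> x y + \<epsilon>"
    by (rule cInf_lessD[THEN bexE])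
  then obtain n :: nat and f a b q where q: "l = (\<Sum>i<n. poincare_dist (a i) (b i))" "q 0 = x" "q n = y"
    and "\<forall>i<n. holomorphic_disc X A \<Omega> (f i) \<and> a i \<in> ball 0 1 \<and> b i \<in> ball 0 1 \<and>
             f i (a i) = q i \<and> f i (b i) = q (Suc i)"
    unfolding mem_Collect_eq by (elim exE conjE)
  note chain = this(4)[THEN spec, THEN mp]
  have "\<Omega> \<subseteq> topspace X" using dom openin_subset by (auto simp: domain_in_def)
  from connected_along_chain[OF met this, of q n f a b] x q(2) chain
  obtain C where "connectedin X C" "C \<subseteq> \<Omega>" "q 0 \<in> C" "q n \<in> C"
    "\<And>z. z \<in> C \<Longrightarrow> kobayashi X A \<Omega> (q 0) z + kobayashi X A \<Omega> z (q n) \<le> l"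
    unfolding q(1) by blast
  then show ?thesis
    using l unfolding q(2,3) by (intro exI[of _ C]) force
qed

lemma locally_compact_complex_manifold:
  assumes mf: "complex_manifold X (A :: ('a set \<times> ('a \<Rightarrow> complex^'n::finite)) set)"
  shows "locally_compact_space X"
  unfolding locally_compact_space_def
proof
  fix x assume "x \<in> topspace X"
  then obtain U \<phi> \<rho> where U: "(U, \<phi>) \<in> A" "x \<in> U" and \<rho>: "0 < \<rho>" "ball (\<phi> x) \<rho> \<subseteq> \<phi> ` (U \<inter> topspace X)"
    using chart_ball[OF mf openin_topspace] by metis
  note chart = complex_manifoldD[OF mf U(1)]
  have "cball (\<phi> x) (\<rho>/2) \<subseteq> ball (\<phi> x) \<rho>" using \<rho>(1) by (simp add: cball_subset_ball_iff)
  then have "cball (\<phi> x) (\<rho>/2) \<subseteq> \<phi> ` U" using \<rho>(2) by blast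
  then have "compactin (top_of_set (\<phi> ` U)) (cball (\<phi> x) (\<rho>/2))"
    by (simp add: compactin_subtopology)
  then have "compactin X (inv_into U \<phi> ` cball (\<phi> x) (\<rho>/2))"
    using chart(6) image_compactin by blast
  moreover have "{y \<in> U. \<phi> y \<in> ball (\<phi> x) (\<rho>/2)} \<subseteq> inv_into U \<phi> ` cball (\<phi> x) (\<rho>/2)"
  proof clarify
    fix y assume "y \<in> U" "\<phi> y \<in> ball (\<phi> x) (\<rho>/2)"
    then show "y \<in> inv_into U \<phi> ` cball (\<phi> x) (\<rho>/2)"
      using chart(4) by (intro image_eqI[of _ _ "\<phi> y"]) (auto simp: inv_into_f_f)
  qed
  moreover have "x \<in> {y \<in> U. \<phi> y \<in> ball (\<phi> x) (\<rho>/2)}" using U \<rho> by simp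
  ultimately show "\<exists>U K. openin X U \<and> compactin X K \<and> x \<in> U \<and> U \<subseteq> K"
    using openin_chart_ball[OF mf U(1)] by blast
qed

section \<open>Almost geodesic metric spaces\<close>

text \<open>A metric that is merely continuous for a locally compact topology can be strictly coarser than it.
  Almost geodesic connected sets exclude this: a set leading from \<open>x\<close> to a point outside a relatively
  compact neighbourhood meets the compact rim of that neighbourhood, which has positive distance from \<open>x\<close>,
  so the end point cannot be closer than the rim. For the Kobayashi distance this is Barth's theorem.\<close>

lemma (in Metric_space) mtopology_eq_if_almost_geodesic:
  assumes top: "topspace T = M" and loc: "locally_compact_space T" and haus: "Hausdorff_space T"
    and small: "\<And>x \<epsilon>. x \<in> M \<Longrightarrow> 0 < \<epsilon> \<Longrightarrow> \<exists>N. openin T N \<and> x \<in> N \<and> (\<forall>y\<in>N. d x y < \<epsilon>)"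
    and geo: "\<And>x y \<epsilon>. x \<in> M \<Longrightarrow> y \<in> M \<Longrightarrow> 0 < \<epsilon> \<Longrightarrow>
      \<exists>C. connectedin T C \<and> x \<in> C \<and> y \<in> C \<and> (\<forall>z\<in>C. d x z + d z y < d x y + \<epsilon>)"
  shows "mtopology = T"
proof -
  have balls: "openin T (mball x r)" for x r
  proof (subst openin_subopen, clarify)
    fix y assume y: "y \<in> mball x r"
    then obtain N where N: "openin T N" "y \<in> N" "\<And>z. z \<in> N \<Longrightarrow> d y z < r - d x y"
      using small[of y "r - d x y"] by auto
    have "N \<subseteq> mball x r"
    proof
      fix z assume z: "z \<in> N"
      then have "z \<in> M" using N(1) openin_subset top by blast
      then show "z \<in> mball x r"
        using N(3)[OF z] y triangle[of x y z] by auto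
    qed
    with N show "\<exists>N. openin T N \<and> y \<in> N \<and> N \<subseteq> mball x r" by blast
  qed
  have coarser: "openin T W" if "openin mtopology W" for W
  proof (subst openin_subopen, clarify)
    fix x assume x: "x \<in> W"
    then have "\<exists>r>0. mball x r \<subseteq> W" "x \<in> M"
      using that unfolding openin_mtopology by auto
    then obtain r where "0 < r" "mball x r \<subseteq> W" "x \<in> M" by blast
    then show "\<exists>N. openin T N \<and> x \<in> N \<and> N \<subseteq> W"
      using balls[of x r] by (intro exI[of _ "mball x r"]) simp
  qed
  have "openin mtopology W" if W: "openin T W" for W
    unfolding openin_mtopology
  proof (intro conjI allI impI)
    show "W \<subseteq> M" using W openin_subset top by blast
    fix x assume x: "x \<in> W"
    then have xM: "x \<in> M" using \<open>W \<subseteq> M\<close> by blast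
    obtain U L where U: "openin T U" "x \<in> U" "U \<subseteq> L" "L \<subseteq> W" and L: "compactin T L"
    proof -
      have "neighbourhood_base_of (compactin T) T"
        using loc locally_compact_space_neighbourhood_base[OF disjI1[OF haus]] by blast
      then have "\<exists>U V. openin T U \<and> compactin T V \<and> x \<in> U \<and> U \<subseteq> V \<and> V \<subseteq> W"
        using W x unfolding neighbourhood_base_of by blast
      then show ?thesis using that by (elim exE conjE)
    qed
    have "compactin T (L - U)"
      using compact_Int_closedin[OF L, of "topspace T - U"] U(1) compactin_subset_topspace[OF L]
      by (metis Int_Diff Int_absorb2 closedin_diff closedin_topspace)
    moreover have "continuous_map T mtopology id"
      unfolding continuous_map_def
    proof (intro conjI allI impI)
      show "id \<in> topspace T \<rightarrow> topspace mtopology" using top by simp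
      fix V assume V: "openin mtopology V"
      have "{x \<in> topspace T. id x \<in> V} = V" using openin_subset[OF V] top by auto
      then show "openin T {x \<in> topspace T. id x \<in> V}" using coarser[OF V] by simp
    qed
    ultimately have "compactin mtopology (L - U)"
      using image_compactin by fastforce
    then have "closedin mtopology (L - U)"
      using Hausdorff_space_mtopology compactin_imp_closedin by blast
    then have "openin mtopology (M - (L - U))" by (metis openin_diff openin_topspace topspace_mtopology)
    then obtain m where m: "0 < m" "mball x m \<subseteq> M - (L - U)"
      using xM U(2) unfolding openin_mtopology by blast
    \<comment> \<open>A ball that avoids the rim \<open>L - U\<close> stays inside \<open>U\<close>.\<close>
    have "mball x m \<subseteq> U"
    proof
      fix y assume y: "y \<in> mball x m"
      then obtain C where C: "connectedin T C" "x \<in> C" "y \<in> C" "\<And>z. z \<in> C \<Longrightarrow> d x z + d z y < d x y + (m - d x y)"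
        using geo[of x y "m - d x y"] by auto
      have "C \<subseteq> M" using C(1) connectedin_subset_topspace top by blast
      have "C \<subseteq> mball x m"
      proof
        fix z assume z: "z \<in> C"
        then show "z \<in> mball x m"
          using C(4)[OF z] nonneg[of z y] xM \<open>C \<subseteq> M\<close> by (auto simp del: nonneg)
      qed
      then have "C \<subseteq> U \<union> (M - L)" using m(2) by blast
      moreover have "openin T (M - L)"
        using L haus compactin_imp_closedin top by blast
      moreover have "U \<inter> (M - L) = {}" using U by blast
      ultimately have "(M - L) \<inter> C = {}"
        using connectedinD[OF C(1) U(1), of "M - L"] C(2) U(2) by (metis Int_empty_left IntI empty_iff)
      then show "y \<in> U" using C(3) \<open>C \<subseteq> U \<union> (M - L)\<close> by blast
    qed
    then show "\<exists>r>0. mball x r \<subseteq> W" using m(1) U by blast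
  qed
  with coarser show ?thesis
    by (intro topology_eq[THEN iffD2]) blast
qed

lemma (in Metric_space) continuous_map_distance: "continuous_map mtopology euclideanreal (d x)" if x: "x \<in> M"
  unfolding continuous_map_from_metric
proof (intro conjI ballI allI impI)
  fix a U assume a: "a \<in> M" and U: "openin euclideanreal U \<and> d x a \<in> U"
  then obtain r where r: "0 < r" "\<And>s. \<bar>s - d x a\<bar> < r \<Longrightarrow> s \<in> U"
    unfolding open_openin[symmetric] open_dist by (auto simp: dist_real_def)
  have "d x y \<in> U" if "y \<in> M" "d a y < r" for y
    using r(2)[of "d x y"] that a x triangle[of x a y] triangle[of x y a] commute[of a y] by force
  then show "\<exists>r>0. \<forall>y. y \<in> M \<and> d a y < r \<longrightarrow> d x y \<in> U" using r(1) by blast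
qed simp

text \<open>The Hopf--Rinow theorem for length spaces. Let \<open>s\<close> be the supremum of the radii of compact
  balls about \<open>p\<close>. Points of the ball of radius \<open>s\<close> are close to smaller, compact balls, so that ball is
  totally bounded and, by completeness, compact. Local compactness gives it a compact neighbourhood, which
  contains a slightly larger ball, and this contradicts the choice of \<open>s\<close>.\<close>

lemma (in Metric_space) compactin_mcball_if_almost_geodesic:
  assumes compl: mcomplete and loc: "locally_compact_space mtopology"
    and geo: "\<And>x y t \<epsilon>. x \<in> M \<Longrightarrow> y \<in> M \<Longrightarrow> 0 \<le> t \<Longrightarrow> t \<le> d x y \<Longrightarrow> 0 < \<epsilon> \<Longrightarrow>
      \<exists>z\<in>M. d x z = t \<and> d z y < d x y - t + \<epsilon>"
  shows "compactin mtopology (mcball p R)"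
proof (rule ccontr)
  assume R: "\<not> ?thesis"
  then have p: "p \<in> M" by (metis compactin_empty mcball_eq_empty)
  define S where "S = {r. 0 \<le> r \<and> compactin mtopology (mcball p r)}"
  have down: "compactin mtopology (mcball p r)" if "compactin mtopology (mcball p r')" "r \<le> r'" for r r'
    using closed_compactin[OF that(1) mcball_subset_concentric[OF that(2)]] by simp
  have "mcball p 0 = {p}" using p by (auto simp del: mdist_pos_eq) (metis mdist_pos_less not_less)
  then have S0: "0 \<in> S" using p by (simp add: S_def)
  have SR: "r \<le> R" if "r \<in> S" for r
    using that R down[of r R] by (force simp: S_def)
  then have bdd: "bdd_above S" by (rule bdd_aboveI)
  define s where "s = Sup S"
  have s0: "0 \<le> s" unfolding s_def using S0 bdd by (rule cSup_upper)
  have below: "compactin mtopology (mcball p r)" if r: "r < s" for r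
  proof -
    obtain r' where "r' \<in> S" "r < r'" using less_cSupD[of S r] S0 r unfolding s_def by blast
    then show ?thesis using down[of r' r] by (simp add: S_def)
  qed
  have "mtotally_bounded (mcball p s)"
    unfolding mtotally_bounded_def
  proof (intro allI impI)
    fix \<epsilon> :: real assume \<epsilon>: "0 < \<epsilon>"
    define t where "t = max 0 (s - \<epsilon>/3)"
    have "compactin mtopology (mcball p t)"
      using below[of t] S0 \<epsilon> by (cases "s - \<epsilon>/3 \<le> 0") (auto simp: t_def S_def)
    then have "mtotally_bounded (mcball p t)" by (rule compactin_imp_mtotally_bounded)
    then obtain F where F: "finite F" "F \<subseteq> mcball p t" "mcball p t \<subseteq> (\<Union>x\<in>F. mball x (\<epsilon>/3))"
      using \<epsilon> unfolding mtotally_bounded_def by (meson divide_pos_pos zero_less_numeral)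
    have "mcball p s \<subseteq> (\<Union>x\<in>F. mball x \<epsilon>)"
    proof
      fix y assume y: "y \<in> mcball p s"
      have "\<exists>z\<in>mcball p t. d z y < 2 * \<epsilon> / 3"
      proof (cases "d p y \<le> t")
        case True
        then show ?thesis using y \<epsilon> by (intro bexI[of _ y]) auto
      next
        case False
        obtain z where "z \<in> M" "d p z = t" "d z y < d p y - t + \<epsilon>/3"
          using geo[of p y t "\<epsilon>/3"] False y \<epsilon> by (auto simp: t_def not_le)
        moreover have "s - t \<le> \<epsilon>/3" by (simp add: t_def max_def)
        ultimately show ?thesis using y by (intro bexI[of _ z]) auto
      qed
      then obtain z where z: "z \<in> mcball p t" "d z y < 2 * \<epsilon> / 3" by blast
      then obtain x where x: "x \<in> F" "z \<in> mball x (\<epsilon>/3)" using F by blast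
      then have "y \<in> mball x \<epsilon>" using z y triangle[of x z y] by auto
      then show "y \<in> (\<Union>x\<in>F. mball x \<epsilon>)" using x by blast
    qed
    moreover have "t \<le> s" using s0 \<epsilon> by (simp add: t_def)
    ultimately show "\<exists>F. finite F \<and> F \<subseteq> mcball p s \<and> mcball p s \<subseteq> (\<Union>x\<in>F. mball x \<epsilon>)"
      using F mcball_subset_concentric[of t s p] by blast
  qed
  then have comp: "compactin mtopology (mcball p s)"
    using mtotally_bounded_eq_compact_closure_of[OF compl, of "mcball p s"]
    by (simp add: closure_of_closedin)
  obtain U L where U: "openin mtopology U" "mcball p s \<subseteq> U" "U \<subseteq> L" and L: "compactin mtopology L"
  proof -
    have "\<forall>x\<in>mcball p s. \<exists>U L. openin mtopology U \<and> compactin mtopology L \<and> x \<in> U \<and> U \<subseteq> L"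
      using loc unfolding locally_compact_space_def by simp
    then obtain u l where ul: "\<And>x. x \<in> mcball p s \<Longrightarrow> openin mtopology (u x)"
      "\<And>x. x \<in> mcball p s \<Longrightarrow> compactin mtopology (l x)"
      "\<And>x. x \<in> mcball p s \<Longrightarrow> x \<in> u x" "\<And>x. x \<in> mcball p s \<Longrightarrow> u x \<subseteq> l x"
      by metis
    obtain F where F: "finite F" "F \<subseteq> u ` mcball p s" "mcball p s \<subseteq> \<Union>F"
      using compactinD[OF comp, of "u ` mcball p s"] ul(1,3) by blast
    then obtain G where G: "finite G" "G \<subseteq> mcball p s" "F = u ` G"
      using finite_subset_image[OF F(1,2)] by (elim exE conjE)
    show ?thesis
    proof
      show "openin mtopology (\<Union>x\<in>G. u x)" using G ul(1) by (intro openin_Union) blast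
      show "mcball p s \<subseteq> (\<Union>x\<in>G. u x)" using F(3) G(3) by simp
      show "(\<Union>x\<in>G. u x) \<subseteq> (\<Union>x\<in>G. l x)" proof (rule UN_mono[OF order_refl])
        show "u x \<subseteq> l x" if "x \<in> G" for x using subsetD[OF G(2) that] by (rule ul(4))
      qed
      show "compactin mtopology (\<Union>x\<in>G. l x)"
        using G ul(2) by (intro compactin_Union) auto
    qed
  qed
  obtain \<delta> where \<delta>: "0 < \<delta>" "\<And>x. x \<in> mcball p s \<Longrightarrow> mball x \<delta> \<subseteq> U"
    using lebesgue_number[OF comp, of "{U}"] U(1,2) by auto
  have "mcball p (s + \<delta>/2) \<subseteq> L"
  proof
    fix y assume y: "y \<in> mcball p (s + \<delta>/2)"
    show "y \<in> L"
    proof (cases "d p y \<le> s")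
      case True
      then show ?thesis using y U(2,3) by auto
    next
      case False
      then obtain z where "z \<in> M" "d p z = s" "d z y < d p y - s + \<delta>/2"
        using geo[of p y s "\<delta>/2"] y \<delta> s0 by auto
      then have "y \<in> mball z \<delta>" "z \<in> mcball p s" using y p by auto
      then show ?thesis using \<delta>(2)[of z] U(3) by blast
    qed
  qed
  then have "compactin mtopology (mcball p (s + \<delta>/2))"
    using closed_compactin[OF L] by simp
  then have "s + \<delta>/2 \<in> S" using s0 \<delta>(1) by (simp add: S_def)
  then have "s + \<delta>/2 \<le> s" unfolding s_def using bdd by (rule cSup_upper)
  then show False using \<delta>(1) by simp
qed

text \<open>The intermediate value theorem for the distance from \<open>x\<close> on the connected set \<open>C\<close>.\<close>

lemma (in Metric_space) point_at_distance_on_almost_geodesic: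
  assumes C: "connectedin mtopology C" "x \<in> C" "y \<in> C"
    and less: "\<And>z. z \<in> C \<Longrightarrow> d x z + d z y < d x y + \<epsilon>" and t: "0 \<le> t" "t \<le> d x y"
  shows "\<exists>z\<in>M. d x z = t \<and> d z y < d x y - t + \<epsilon>"
proof -
  have CM: "C \<subseteq> M" using connectedin_subset_topspace[OF C(1)] by simp
  have "connected (d x ` C)"
    using connectedin_continuous_map_image[OF continuous_map_distance C(1)] C(2) CM by auto
  moreover have "0 \<in> d x ` C" using C(2) CM by (metis image_eqI mdist_zero subsetD)
  moreover have "d x y \<in> d x ` C" using C(3) by blast
  ultimately have "t \<in> d x ` C" using connected_contains_Icc[of "d x ` C" 0 "d x y"] t by auto
  then obtain z where "z \<in> C" "d x z = t" by auto
  then show ?thesis using less[of z] CM by (intro bexI[of _ z]) auto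
qed

section \<open>The metric compactification of a proper metric space\<close>

lemma abs_add3_less:
  fixes a b c e h s :: real
  assumes "\<bar>a - b\<bar> < (e - s) / 2" "\<bar>c - k\<bar> < (e - s) / 2" "\<bar>b - k - h\<bar> \<le> s"
  shows "\<bar>a - c - h\<bar> < e"
proof -
  have "a - b < (e - s) / 2" "b - a < (e - s) / 2" "c - k < (e - s) / 2" "k - c < (e - s) / 2"
    "b - k - h \<le> s" "- (b - k - h) \<le> s"
    using assms[unfolded abs_less_iff abs_le_iff] by linarith+
  then have "a - c - h < e" "- (a - c - h) < e" by argo+
  then show ?thesis by (simp add: abs_less_iff)
qed

text \<open>In a proper space uniform convergence on compact sets is uniform convergence on balls about the
  base point, which gives the compactification countable neighbourhood bases.\<close>

locale proper_metric_space = Metric_space M d for M :: "'a set" and d +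
  fixes p :: 'a
  assumes basepoint: "p \<in> M"
    and compactin_mcball: "\<And>x r. compactin mtopology (mcball x r)"
begin

abbreviation "horo \<equiv> horofunction p"
abbreviation "quotient_topology \<equiv> cont_mod_const_topology mtopology"
abbreviation "\<iota> \<equiv> metric_embedding mtopology d"
abbreviation "compactified \<equiv> metric_compactification mtopology d"

lemma cont_funs_restrict:
  "continuous_map mtopology euclideanreal f \<Longrightarrow> restrict f M \<in> cont_funs mtopology"
  unfolding cont_funs_def by (auto elim: continuous_map_eq)

lemma cont_funsD:
  assumes "f \<in> cont_funs mtopology"
  shows "continuous_map mtopology euclideanreal f" "f \<in> extensional M"
  using assms by (auto simp: cont_funs_def)

lemma mod_const_eqI:
  assumes "f \<in> cont_funs mtopology" "g \<in> cont_funs mtopology" "\<And>z. z \<in> M \<Longrightarrow> g z = f z + c"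
  shows "mod_const mtopology f = mod_const mtopology g"
  unfolding mod_const_def
  by (rule equiv_class_eq[OF equiv_differ_by_const]) (use assms in \<open>auto simp: differ_by_const_def\<close>)

text \<open>The horofunction of a class is its only representative that vanishes at the base point; this turns
  statements about the quotient into statements about functions.\<close>

lemma horofunction_mod_const:
  assumes f: "f \<in> cont_funs mtopology"
  shows "horo (mod_const mtopology f) = restrict (\<lambda>z. f z - f p) M"
  unfolding horofunction_def
proof (rule the_equality)
  have "restrict (\<lambda>z. f z - f p) M \<in> cont_funs mtopology"
    by (intro cont_funs_restrict continuous_intros cont_funsD(1)[OF f])
  then show "restrict (\<lambda>z. f z - f p) M \<in> mod_const mtopology f \<and> restrict (\<lambda>z. f z - f p) M p = 0"
    using f basepoint by (auto simp: mod_const_def differ_by_const_def intro!: exI[of _ "- f p"])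
next
  fix g assume g: "g \<in> mod_const mtopology f \<and> g p = 0"
  then obtain c where c: "g \<in> cont_funs mtopology" "\<And>z. z \<in> M \<Longrightarrow> g z = f z + c"
    by (auto simp: mod_const_def differ_by_const_def)
  then have "c = - f p" using g basepoint by force
  then show "g = restrict (\<lambda>z. f z - f p) M"
    using c(2) cont_funsD(2)[OF c(1)] by (intro extensionalityI[of _ M]) auto
qed

lemma horofunction_in_class:
  assumes "\<xi> \<in> topspace quotient_topology"
  shows "horo \<xi> \<in> cont_funs mtopology" "mod_const mtopology (horo \<xi>) = \<xi>" "horo \<xi> p = 0"
proof -
  obtain f where f: "f \<in> cont_funs mtopology" "\<xi> = mod_const mtopology f"
    using assms unfolding topspace_cont_mod_const_topology by (auto simp: mod_const_def quotient_def)
  note h = horofunction_mod_const[OF f(1), folded f(2)]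
  show cf: "horo \<xi> \<in> cont_funs mtopology"
    unfolding h by (intro cont_funs_restrict continuous_intros cont_funsD(1)[OF f(1)])
  show "mod_const mtopology (horo \<xi>) = \<xi>"
    unfolding f(2) by (rule mod_const_eqI[symmetric, OF f(1) cf[unfolded f(2)], of "- f p"])
      (simp add: h[unfolded f(2)])
  show "horo \<xi> p = 0" unfolding h using basepoint by simp
qed

lemma mod_const_in_quotient:
  "f \<in> cont_funs mtopology \<Longrightarrow> mod_const mtopology f \<in> topspace quotient_topology"
  unfolding topspace_cont_mod_const_topology mod_const_def by (rule quotientI)

lemma embed_in_quotient: "x \<in> M \<Longrightarrow> \<iota> x \<in> topspace quotient_topology"
  unfolding metric_embedding_def
  by (intro mod_const_in_quotient) (simp add: cont_funs_restrict continuous_map_distance)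

lemma horofunction_embed:
  assumes "x \<in> M" "z \<in> M"
  shows "horo (\<iota> x) z = d x z - d x p"
  using horofunction_mod_const[OF cont_funs_restrict[OF continuous_map_distance[OF assms(1)]]] assms basepoint
  by (simp add: metric_embedding_def)

lemma inj_embed:
  assumes "x \<in> M" "y \<in> M" "\<iota> x = \<iota> y"
  shows "x = y"
proof -
  have "d x z - d x p = d y z - d y p" if "z \<in> M" for z
    using horofunction_embed[OF assms(1) that] horofunction_embed[OF assms(2) that] assms(3) by simp
  note this[OF assms(1)] this[OF assms(2)]
  then have "d x y = 0"
    using commute[of x y] mdist_zero[OF assms(1)] mdist_zero[OF assms(2)] by linarith
  then show ?thesis using assms by simp
qed

lemma topspace_compactified: "topspace compactified = quotient_topology closure_of (\<iota> ` M)"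
  unfolding metric_compactification_def by (simp add: closure_of_subset_topspace Int_absorb1)

lemma compactified_in_quotient: "\<xi> \<in> topspace compactified \<Longrightarrow> \<xi> \<in> topspace quotient_topology"
  unfolding topspace_compactified by (meson closure_of_subset_topspace subsetD)

lemma embed_in_compactified: "x \<in> M \<Longrightarrow> \<iota> x \<in> topspace compactified"
  unfolding topspace_compactified using closure_of_subset[of "\<iota> ` M" quotient_topology] embed_in_quotient
  by blast

text \<open>Basic neighbourhoods of a class, expressed through normalised representatives, so that no constants
  have to be matched.\<close>

definition uniform_nbhd :: "('a \<Rightarrow> real) set \<Rightarrow> 'a set \<Rightarrow> real \<Rightarrow> ('a \<Rightarrow> real) set set" where
  "uniform_nbhd \<xi> C \<epsilon> = {\<eta> \<in> topspace quotient_topology. \<forall>z\<in>C. \<bar>horo \<eta> z - horo \<xi> z\<bar> < \<epsilon>}"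

lemma bounded_away_on_compact:
  assumes C: "compactin T C" and f: "continuous_map T euclideanreal f" and lt: "\<And>z. z \<in> C \<Longrightarrow> f z < \<epsilon>"
  shows "\<exists>s<\<epsilon>. \<forall>z\<in>C. f z \<le> s"
proof (cases "C = {}")
  case True
  then show ?thesis by (intro exI[of _ "\<epsilon> - 1"]) simp
next
  case False
  have "compact (f ` C)" using image_compactin[OF C f] by simp
  then obtain z where "z \<in> C" "\<And>y. y \<in> C \<Longrightarrow> f y \<le> f z"
    using compact_attains_sup[of "f ` C"] False by auto
  then show ?thesis using lt by (intro exI[of _ "f z"]) auto
qed

text \<open>Compactness of \<open>C\<close> turns a strict bound at each point into a uniform gap, which leaves room for
  perturbing the function.\<close>

lemma openin_uniform_nbhd:
  assumes C: "compactin mtopology C" and \<xi>: "\<xi> \<in> topspace quotient_topology"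
  shows "openin quotient_topology (uniform_nbhd \<xi> C \<epsilon>)"
proof -
  have CM: "C \<subseteq> M" using compactin_subset_topspace[OF C] by simp
  have eq: "mod_const mtopology f \<in> uniform_nbhd \<xi> C \<epsilon> \<longleftrightarrow> (\<forall>z\<in>C. \<bar>f z - f p - horo \<xi> z\<bar> < \<epsilon>)"
    if "f \<in> cont_funs mtopology" for f
    using CM horofunction_mod_const[OF that] mod_const_in_quotient[OF that] by (auto simp: uniform_nbhd_def)
  have "cont_open mtopology {f \<in> cont_funs mtopology. mod_const mtopology f \<in> uniform_nbhd \<xi> C \<epsilon>}"
  proof (rule cont_openI)
    fix f assume "f \<in> {f \<in> cont_funs mtopology. mod_const mtopology f \<in> uniform_nbhd \<xi> C \<epsilon>}"
    then have f: "f \<in> cont_funs mtopology" "\<And>z. z \<in> C \<Longrightarrow> \<bar>f z - f p - horo \<xi> z\<bar> < \<epsilon>" using eq by auto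
    have "continuous_map mtopology euclideanreal (\<lambda>z. \<bar>f z - f p - horo \<xi> z\<bar>)"
      by (intro continuous_intros cont_funsD(1)[OF f(1)] cont_funsD(1)[OF horofunction_in_class(1)[OF \<xi>]])
    from bounded_away_on_compact[OF C this f(2)]
    obtain s where s: "s < \<epsilon>" "\<And>z. z \<in> C \<Longrightarrow> \<bar>f z - f p - horo \<xi> z\<bar> \<le> s" by auto
    \<comment> \<open>Perturbing \<open>f\<close> also changes its value at \<open>p\<close>, hence half of the gap for each of the two.\<close>
    have "{g \<in> cont_funs mtopology. \<forall>z\<in>insert p C. \<bar>g z - f z\<bar> < (\<epsilon> - s) / 2} \<subseteq>
        {f \<in> cont_funs mtopology. mod_const mtopology f \<in> uniform_nbhd \<xi> C \<epsilon>}"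
    proof
      fix g assume g: "g \<in> {g \<in> cont_funs mtopology. \<forall>z\<in>insert p C. \<bar>g z - f z\<bar> < (\<epsilon> - s) / 2}"
      have "\<bar>g z - g p - horo \<xi> z\<bar> < \<epsilon>" if z: "z \<in> C" for z
      proof -
        have "\<bar>g z - f z\<bar> < (\<epsilon> - s) / 2" "\<bar>g p - f p\<bar> < (\<epsilon> - s) / 2" using g z by auto
        then show ?thesis using s(2)[OF z] by (rule abs_add3_less)
      qed
      then show "g \<in> {f \<in> cont_funs mtopology. mod_const mtopology f \<in> uniform_nbhd \<xi> C \<epsilon>}"
        using g eq[of g] by auto
    qed
    moreover have "compactin mtopology (insert p C)"
      using compactin_Un[of mtopology "{p}" C] C basepoint by simp
    ultimately show "\<exists>C' \<epsilon>'. compactin mtopology C' \<and> 0 < \<epsilon>' \<and>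
        {g \<in> cont_funs mtopology. \<forall>z\<in>C'. \<bar>g z - f z\<bar> < \<epsilon>'} \<subseteq>
        {f \<in> cont_funs mtopology. mod_const mtopology f \<in> uniform_nbhd \<xi> C \<epsilon>}"
      using s(1) by (intro exI[of _ "insert p C"] exI[of _ "(\<epsilon> - s) / 2"]) simp
  qed simp
  then show ?thesis
    unfolding openin_cont_mod_const_topology openin_cont_topology
    by (auto simp: uniform_nbhd_def topspace_cont_mod_const_topology)
qed

lemma in_uniform_nbhd: "\<xi> \<in> topspace quotient_topology \<Longrightarrow> 0 < \<epsilon> \<Longrightarrow> \<xi> \<in> uniform_nbhd \<xi> C \<epsilon>"
  by (simp add: uniform_nbhd_def)

lemma uniform_nbhd_base_compact:
  assumes W: "openin quotient_topology W" and \<xi>: "\<xi> \<in> W"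
  obtains C \<epsilon> where "compactin mtopology C" "0 < \<epsilon>" "uniform_nbhd \<xi> C \<epsilon> \<subseteq> W"
proof -
  have \<xi>q: "\<xi> \<in> topspace quotient_topology" using W \<xi> openin_subset by blast
  have "cont_open mtopology {f \<in> cont_funs mtopology. mod_const mtopology f \<in> W}"
    using W unfolding openin_cont_mod_const_topology openin_cont_topology by blast
  moreover have "horo \<xi> \<in> {f \<in> cont_funs mtopology. mod_const mtopology f \<in> W}"
    using horofunction_in_class[OF \<xi>q] \<xi> by simp
  ultimately obtain C \<epsilon> where C: "compactin mtopology C" "0 < \<epsilon>"
    "{g \<in> cont_funs mtopology. \<forall>z\<in>C. \<bar>g z - horo \<xi> z\<bar> < \<epsilon>} \<subseteq> {f \<in> cont_funs mtopology. mod_const mtopology f \<in> W}"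
    unfolding cont_open_def by blast
  have "uniform_nbhd \<xi> C \<epsilon> \<subseteq> W"
  proof
    fix \<eta> assume \<eta>: "\<eta> \<in> uniform_nbhd \<xi> C \<epsilon>"
    then have \<eta>q: "\<eta> \<in> topspace quotient_topology" by (simp add: uniform_nbhd_def)
    then have "horo \<eta> \<in> {g \<in> cont_funs mtopology. \<forall>z\<in>C. \<bar>g z - horo \<xi> z\<bar> < \<epsilon>}"
      using \<eta> horofunction_in_class(1)[OF \<eta>q] by (simp add: uniform_nbhd_def)
    then show "\<eta> \<in> W" using C(3) horofunction_in_class(2)[OF \<eta>q] by auto
  qed
  with C that show ?thesis by blast
qed

abbreviation "nbhd_seq \<xi> n \<equiv> uniform_nbhd \<xi> (mcball p (real n)) (1 / real (Suc n))"

lemma nbhd_seq_antimono: "m \<le> n \<Longrightarrow> nbhd_seq \<xi> n \<subseteq> nbhd_seq \<xi> m"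
proof
  fix \<eta> assume mn: "m \<le> n" and \<eta>: "\<eta> \<in> nbhd_seq \<xi> n"
  have "mcball p (real m) \<subseteq> mcball p (real n)" using mn by (intro mcball_subset_concentric) simp
  moreover have "1 / real (Suc n) \<le> 1 / real (Suc m)" using mn by (intro divide_left_mono) auto
  ultimately show "\<eta> \<in> nbhd_seq \<xi> m"
    using \<eta> unfolding uniform_nbhd_def by (fastforce elim: order.strict_trans2)
qed

lemma nbhd_seq_base:
  assumes W: "openin quotient_topology W" and \<xi>: "\<xi> \<in> W"
  obtains n where "nbhd_seq \<xi> n \<subseteq> W"
proof -
  obtain C \<epsilon> where C: "compactin mtopology C" "0 < \<epsilon>" "uniform_nbhd \<xi> C \<epsilon> \<subseteq> W"
    using uniform_nbhd_base_compact[OF W \<xi>] .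
  obtain B where B: "C \<subseteq> mcball p B"
    using compactin_imp_mbounded[OF C(1)] basepoint
    by (meson mbounded_alt_pos mbounded_def mbounded_subset mcball_subset order_trans order_refl)
  obtain n where n: "max B (1/\<epsilon>) < real n" using reals_Archimedean2 by blast
  then have "1 / real (Suc n) < \<epsilon>"
    using C(2) by (simp add: field_simps)
  then have "nbhd_seq \<xi> n \<subseteq> uniform_nbhd \<xi> C \<epsilon>"
    using B n mcball_subset_concentric[of B "real n" p] unfolding uniform_nbhd_def by fastforce
  with C(3) that show ?thesis by blast
qed

lemma openin_nbhd_seq: "\<xi> \<in> topspace quotient_topology \<Longrightarrow> openin quotient_topology (nbhd_seq \<xi> n)"
  by (rule openin_uniform_nbhd[OF compactin_mcball])

text \<open>The compactness of the metric compactification, stated for filters. The normalised distance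
  functions \<open>h\<close> lie in a product of compact intervals, so by Tychonoff's theorem they have a pointwise
  cluster point \<open>g\<close>. It is 1-Lipschitz as they are, and for 1-Lipschitz functions closeness on a finite net of
  a compact set gives closeness on the whole set, so that \<open>g\<close> is a cluster point for locally uniform
  convergence too. Filters replace sequences because a boundary point of another compactification need
  not be a limit of a sequence of interior points.\<close>

lemma embed_cluster_point:
  assumes F: "F \<noteq> bot" and FM: "eventually (\<lambda>w. w \<in> M) F"
  shows "\<exists>\<xi>\<in>topspace compactified. \<forall>U P. openin quotient_topology U \<longrightarrow> \<xi> \<in> U \<longrightarrow>
    eventually P F \<longrightarrow> (\<exists>w\<in>M. P w \<and> \<iota> w \<in> U)"
proof -
  define h where "h w z = (if z \<in> M then d w z - d w p else 0)" for w z
  define B where "B = (\<Pi>\<^sub>E z\<in>UNIV. cball 0 (if z \<in> M then d p z else 0) :: real set)"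
  have "compactin (product_topology (\<lambda>_. euclidean) UNIV) B"
    unfolding B_def by (subst compactin_PiE) auto
  then have B: "compact B" unfolding euclidean_product_topology by simp
  have "h w \<in> B" if "w \<in> M" for w
    using that basepoint mdist_reverse_triangle[of p w z for z] commute[of w p]
    by (auto simp: B_def h_def PiE_def abs_minus_commute)
  then have "eventually (\<lambda>g. g \<in> B) (filtermap h F)"
    using FM unfolding eventually_filtermap by (auto elim: eventually_mono)
  moreover have "filtermap h F \<noteq> bot" using F by (simp add: filtermap_bot_iff)
  ultimately obtain g where g: "g \<in> B" "inf (nhds g) (filtermap h F) \<noteq> bot"
    using B unfolding compact_filter by blast
  have approx: "\<exists>w\<in>M. P w \<and> (\<forall>z\<in>Z. \<bar>h w z - g z\<bar> < \<epsilon>)"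
    if P: "eventually P F" and Z: "finite Z" and \<epsilon>: "0 < \<epsilon>" for P Z \<epsilon>
  proof (rule ccontr)
    assume none: "\<not> ?thesis"
    have "\<forall>\<^sub>F f in nhds g. \<bar>f z - g z\<bar> < \<epsilon>" for z
      unfolding eventually_nhds
    proof (intro exI conjI ballI)
      show "open ((\<lambda>f. f z) -` ball (g z) \<epsilon> :: ('a \<Rightarrow> real) set)"
        by (rule open_vimage[OF open_ball continuous_on_product_coordinates])
    qed (use \<epsilon> in \<open>auto simp: dist_real_def abs_minus_commute\<close>)
    then have "\<forall>\<^sub>F f in nhds g. \<forall>z\<in>Z. \<bar>f z - g z\<bar> < \<epsilon>"
      using Z by (simp add: eventually_ball_finite)
    moreover have "\<forall>\<^sub>F f in filtermap h F. \<not> (\<forall>z\<in>Z. \<bar>f z - g z\<bar> < \<epsilon>)"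
      unfolding eventually_filtermap using P FM by eventually_elim (use none in blast)
    ultimately have "\<forall>\<^sub>F f in inf (nhds g) (filtermap h F). False"
      unfolding eventually_inf by blast
    then show False using g(2) by (simp add: trivial_limit_def)
  qed
  have h_lip: "\<bar>h w z - h w z'\<bar> \<le> d z z'" if "w \<in> M" "z \<in> M" "z' \<in> M" for w z z'
    using that mdist_reverse_triangle[of z w z'] commute[of w z] by (simp add: h_def)
  have lip: "\<bar>g z - g z'\<bar> \<le> d z z'" if z: "z \<in> M" "z' \<in> M" for z z'
  proof (rule field_le_epsilon)
    fix \<epsilon> :: real assume "0 < \<epsilon>"
    then obtain w where "w \<in> M" "\<forall>y\<in>{z, z'}. \<bar>h w y - g y\<bar> < \<epsilon>/2"
      using approx[of "\<lambda>_. True" "{z, z'}" "\<epsilon>/2"] by auto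
    then have "w \<in> M" "\<bar>h w z - g z\<bar> < \<epsilon>/2" "\<bar>h w z' - g z'\<bar> < \<epsilon>/2" by auto
    then show "\<bar>g z - g z'\<bar> \<le> d z z' + \<epsilon>"
      using h_lip[of w z z'] z by linarith
  qed
  have "g p \<in> cball 0 (if p \<in> M then d p p else 0)" using g(1) unfolding B_def by (rule PiE_mem) simp
  then have gp: "g p = 0" using basepoint by simp
  have "continuous_map mtopology euclideanreal g"
    unfolding continuous_map_from_metric
  proof (intro conjI ballI allI impI)
    fix a U assume a: "a \<in> M" and U: "openin euclideanreal U \<and> g a \<in> U"
    then obtain r where r: "0 < r" "\<And>s. \<bar>s - g a\<bar> < r \<Longrightarrow> s \<in> U"
      unfolding open_openin[symmetric] open_dist by (auto simp: dist_real_def)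
    have "g y \<in> U" if "y \<in> M" "d a y < r" for y
      using r(2)[of "g y"] that a lip[of y a] commute[of a y] by force
    then show "\<exists>r>0. \<forall>y. y \<in> M \<and> d a y < r \<longrightarrow> g y \<in> U" using r(1) by blast
  qed simp
  then have gc: "restrict g M \<in> cont_funs mtopology" by (rule cont_funs_restrict)
  define \<xi> where "\<xi> = mod_const mtopology (restrict g M)"
  have \<xi>q: "\<xi> \<in> topspace quotient_topology" unfolding \<xi>_def by (rule mod_const_in_quotient[OF gc])
  have h\<xi>: "horo \<xi> z = g z" if "z \<in> M" for z
    unfolding \<xi>_def using horofunction_mod_const[OF gc] that gp basepoint by simp
  have cluster: "\<exists>w\<in>M. P w \<and> \<iota> w \<in> U"
    if U: "openin quotient_topology U" "\<xi> \<in> U" and P: "eventually P F" for U P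
  proof -
    obtain C \<epsilon> where C: "compactin mtopology C" "0 < \<epsilon>" "uniform_nbhd \<xi> C \<epsilon> \<subseteq> U"
      using uniform_nbhd_base_compact[OF U] .
    obtain Z where Z: "finite Z" "Z \<subseteq> C" "C \<subseteq> (\<Union>z\<in>Z. mball z (\<epsilon>/4))"
      using compactin_imp_mtotally_bounded[OF C(1)] C(2) unfolding mtotally_bounded_def
      by (meson divide_pos_pos zero_less_numeral)
    obtain w where w: "w \<in> M" "P w" "\<And>z. z \<in> Z \<Longrightarrow> \<bar>h w z - g z\<bar> < \<epsilon>/4"
      using approx[OF P Z(1), of "\<epsilon>/4"] C(2) by auto
    have "\<bar>horo (\<iota> w) y - horo \<xi> y\<bar> < \<epsilon>" if y: "y \<in> C" for y
    proof -
      obtain z where z: "z \<in> Z" "y \<in> mball z (\<epsilon>/4)" using Z(3) y by blast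
      then have yz: "y \<in> M" "z \<in> M" "d z y < \<epsilon>/4" by auto
      have "horo (\<iota> w) y = h w y" using horofunction_embed[OF w(1) yz(1)] yz by (simp add: h_def)
      then show ?thesis
        using h\<xi>[OF yz(1)] w(3)[OF z(1)] lip[OF yz(2,1)] h_lip[OF w(1) yz(2,1)] yz(3) by linarith
    qed
    then have "\<iota> w \<in> uniform_nbhd \<xi> C \<epsilon>"
      using embed_in_quotient[OF w(1)] by (simp add: uniform_nbhd_def)
    with w C(3) show ?thesis by blast
  qed
  have "\<xi> \<in> topspace compactified"
    unfolding topspace_compactified in_closure_of using \<xi>q cluster[of _ "\<lambda>_. True"] by auto
  with cluster show ?thesis by blast
qed

end

section \<open>Comparison of two compactifications\<close>

text \<open>What the argument needs to know about the end compactification \<open>E\<close> with its inclusion \<open>j\<close>: it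
  contains the proper, almost geodesic space \<open>M\<close> as an open subset, bounded sequences of \<open>M\<close> do not escape
  to its boundary, sequences of \<open>E\<close> have convergent subsequences, and the big horospheres shrink to single
  boundary points.\<close>

locale horospherical_compactification = proper_metric_space M d p for M :: "'a set" and d p +
  fixes E :: "'b topology" and j :: "'a \<Rightarrow> 'b" and approach :: "'b \<Rightarrow> 'a filter"
  assumes almost_geodesic: "\<And>x y t \<epsilon>. x \<in> M \<Longrightarrow> y \<in> M \<Longrightarrow> 0 \<le> t \<Longrightarrow> t \<le> d x y \<Longrightarrow> 0 < \<epsilon> \<Longrightarrow>
      \<exists>z\<in>M. d x z = t \<and> d z y < d x y - t + \<epsilon>"
    and inj_j: "inj_on j M"
    and open_j: "\<And>U. openin mtopology U \<Longrightarrow> openin E (j ` U)"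
    and closed_j: "\<And>C. compactin mtopology C \<Longrightarrow> closedin E (j ` C)"
    and seq_compact: "sequentially_compact_space E"
    and approach_def: "\<And>x. approach x = inf (filtercomap j (nhdsin E x)) (principal M)"
    and big_horospheres: "\<And>x. x \<in> topspace E - j ` M \<Longrightarrow>
      (\<Inter>R\<in>{0<..}. E closure_of (j ` {z \<in> M. Liminf (approach x) (\<lambda>w. ereal (d z w - d p w)) < ereal (1/2 * ln R)})) = {x}"
begin

abbreviation "big_horo x R \<equiv> {z \<in> M. Liminf (approach x) (\<lambda>w. ereal (d z w - d p w)) < ereal (1/2 * ln R)}"

text \<open>The filter \<open>approach x\<close> describes points of \<open>M\<close> that tend to \<open>x\<close> in \<open>E\<close>.\<close>

lemma eventually_approach:
  assumes "x \<in> topspace E"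
  shows "eventually P (approach x) \<longleftrightarrow> (\<exists>V. openin E V \<and> x \<in> V \<and> (\<forall>w\<in>M. j w \<in> V \<longrightarrow> P w))"
proof
  assume "eventually P (approach x)"
  then obtain Q where Q: "eventually Q (nhdsin E x)" "\<And>w. Q (j w) \<Longrightarrow> w \<in> M \<Longrightarrow> P w"
    unfolding approach_def eventually_inf_principal eventually_filtercomap by auto
  then obtain V where "openin E V" "x \<in> V" "\<And>v. v \<in> V \<Longrightarrow> Q v"
    using assms unfolding eventually_nhdsin by auto
  with Q(2) show "\<exists>V. openin E V \<and> x \<in> V \<and> (\<forall>w\<in>M. j w \<in> V \<longrightarrow> P w)" by (intro exI[of _ V]) simp
next
  assume "\<exists>V. openin E V \<and> x \<in> V \<and> (\<forall>w\<in>M. j w \<in> V \<longrightarrow> P w)"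
  then obtain V where V: "openin E V" "x \<in> V" "\<And>w. w \<in> M \<Longrightarrow> j w \<in> V \<Longrightarrow> P w" by auto
  then have "eventually (\<lambda>v. v \<in> V) (nhdsin E x)" unfolding eventually_nhdsin by auto
  then show "eventually P (approach x)"
    unfolding approach_def eventually_inf_principal eventually_filtercomap
    using V(3) by (intro exI[of _ "\<lambda>v. v \<in> V"]) simp
qed

lemma j_in: "w \<in> M \<Longrightarrow> j w \<in> topspace E"
  using openin_subset[OF open_j[OF openin_topspace]] by auto

text \<open>The closure of the diagonal copy of \<open>M\<close> in the product of the two compactifications. The proof
  consists in showing that this closed relation is the graph of a map.\<close>

definition cluster :: "('a \<Rightarrow> real) set \<Rightarrow> 'b \<Rightarrow> bool" where
  "cluster \<xi> x \<longleftrightarrow> \<xi> \<in> topspace compactified \<and> x \<in> topspace E \<and>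
    (\<forall>U V. openin quotient_topology U \<longrightarrow> \<xi> \<in> U \<longrightarrow> openin E V \<longrightarrow> x \<in> V \<longrightarrow>
      (\<exists>w\<in>M. \<iota> w \<in> U \<and> j w \<in> V))"

lemma clusterD:
  assumes "cluster \<xi> x"
  shows "\<xi> \<in> topspace compactified" "\<xi> \<in> topspace quotient_topology" "x \<in> topspace E"
    "openin quotient_topology U \<Longrightarrow> \<xi> \<in> U \<Longrightarrow> openin E V \<Longrightarrow> x \<in> V \<Longrightarrow> \<exists>w\<in>M. \<iota> w \<in> U \<and> j w \<in> V"
  using assms compactified_in_quotient unfolding cluster_def by blast+

lemma cluster_uniformly:
  assumes "cluster \<xi> x" "compactin mtopology C" "0 < \<epsilon>" "openin E V" "x \<in> V"
  obtains w where "w \<in> M" "j w \<in> V" "\<And>z. z \<in> C \<Longrightarrow> \<bar>d w z - d w p - horo \<xi> z\<bar> < \<epsilon>"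
proof -
  note c = clusterD[OF assms(1)]
  have CM: "C \<subseteq> M" using compactin_subset_topspace[OF assms(2)] by simp
  obtain w where w: "w \<in> M" "\<iota> w \<in> uniform_nbhd \<xi> C \<epsilon>" "j w \<in> V"
    using c(4)[OF openin_uniform_nbhd[OF assms(2) c(2)] in_uniform_nbhd[OF c(2) assms(3)] assms(4,5)] by blast
  have "\<bar>d w z - d w p - horo \<xi> z\<bar> < \<epsilon>" if z: "z \<in> C" for z
    using w(2) z horofunction_embed[OF w(1) subsetD[OF CM z]] unfolding uniform_nbhd_def by auto
  with w that show ?thesis by blast
qed

lemma cluster_embed: "q \<in> M \<Longrightarrow> cluster (\<iota> q) (j q)"
  unfolding cluster_def using embed_in_compactified j_in by blast

text \<open>If \<open>w\<close> is close to \<open>q\<close>, then the normalised distance functions from \<open>w\<close> and from \<open>q\<close> differ by at most twice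
  that distance, so the only class clustering at an interior point is the embedded point.\<close>

lemma cluster_interior:
  assumes cl: "cluster \<xi> (j q)" and q: "q \<in> M"
  shows "\<xi> = \<iota> q"
proof -
  have horo_eq: "horo \<xi> z = horo (\<iota> q) z" if z: "z \<in> M" for z
  proof -
    have "\<bar>horo \<xi> z - (d q z - d q p)\<bar> \<le> 0 + \<epsilon>" if \<epsilon>: "0 < \<epsilon>" for \<epsilon>
    proof -
      have "openin E (j ` mball q (\<epsilon>/3))" by (intro open_j) simp
      moreover have "j q \<in> j ` mball q (\<epsilon>/3)" using q \<epsilon> by simp
      ultimately obtain w where w: "w \<in> M" "j w \<in> j ` mball q (\<epsilon>/3)" "\<And>y. y \<in> {z} \<Longrightarrow> \<bar>d w y - d w p - horo \<xi> y\<bar> < \<epsilon>/3"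
        using cluster_uniformly[OF cl, of "{z}" "\<epsilon>/3"] z \<epsilon> by auto
      then have "w \<in> mball q (\<epsilon>/3)"
        using inj_on_image_mem_iff[OF inj_j w(1) mball_subset_mspace] by blast
      then have qw: "d q w < \<epsilon>/3" by simp
      have "\<bar>d q z - d w z\<bar> \<le> d q w" "\<bar>d q p - d w p\<bar> \<le> d q w"
        using mdist_reverse_triangle[OF q z w(1)] mdist_reverse_triangle[OF q basepoint w(1)]
        by (simp_all add: commute[of w])
      moreover have "\<bar>d w z - d w p - horo \<xi> z\<bar> \<le> \<epsilon>/3" using w(3)[of z] by simp
      ultimately have "\<bar>d q z - d q p - horo \<xi> z\<bar> < \<epsilon>"
        using qw by (intro abs_add3_less[of _ "d w z" _ "\<epsilon>/3" _ "d w p"]) simp_all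
      then show ?thesis by (simp add: abs_minus_commute)
    qed
    then have "\<bar>horo \<xi> z - (d q z - d q p)\<bar> \<le> 0" by (rule field_le_epsilon)
    then show ?thesis using horofunction_embed[OF q z] by simp
  qed
  have \<iota>q: "\<iota> q \<in> topspace quotient_topology" by (rule embed_in_quotient[OF q])
  note \<xi>q = clusterD(2)[OF cl]
  have "horo \<xi> = horo (\<iota> q)"
    using cont_funsD(2)[OF horofunction_in_class(1)[OF \<xi>q]] cont_funsD(2)[OF horofunction_in_class(1)[OF \<iota>q]] horo_eq
    by (rule extensionalityI)
  then show ?thesis using horofunction_in_class(2)[OF \<xi>q] horofunction_in_class(2)[OF \<iota>q] by metis
qed

text \<open>Points \<open>w\<close> near the boundary are far from the base point \<open>p\<close>. The point at distance \<open>t\<close> from \<open>p\<close> on an almost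
  geodesic to \<open>w\<close> is closer to \<open>w\<close> than \<open>p\<close> is by almost \<open>t\<close>, and it stays in a fixed ball, on which the
  normalised distance from \<open>w\<close> approximates the horofunction uniformly.\<close>

lemma horofunction_unbounded_below:
  assumes cl: "cluster \<xi> x" and x: "x \<notin> j ` M"
  obtains z where "z \<in> M" "horo \<xi> z < c"
proof -
  \<comment> \<open>The 2 pays for the error 1 of the almost geodesic and the error 1 of the approximation.\<close>
  define t where "t = max 0 (2 - c)"
  define V where "V = topspace E - j ` mcball p t"
  have "openin E V" "x \<in> V"
    using closed_j[OF compactin_mcball] clusterD(3)[OF cl] x by (auto simp: V_def)
  then obtain w where w: "w \<in> M" "j w \<in> V" "\<And>z. z \<in> mcball p t \<Longrightarrow> \<bar>d w z - d w p - horo \<xi> z\<bar> < 1"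
    using cluster_uniformly[OF cl compactin_mcball[of p t] zero_less_one] by metis
  have "t \<le> d p w" using w(1,2) basepoint by (force simp: V_def)
  then obtain z where z: "z \<in> M" "d p z = t" "d z w < d p w - t + 1"
    using almost_geodesic[OF basepoint w(1), of t 1] by (auto simp: t_def)
  have "\<bar>d w z - d w p - horo \<xi> z\<bar> < 1" using z basepoint by (intro w(3)) simp
  then have "horo \<xi> z < c" using z(3) commute[of w z] commute[of w p] by (simp add: t_def)
  with z(1) that show ?thesis by blast
qed

text \<open>The distance function from a point of \<open>M\<close>, on the other hand, is bounded below.\<close>

lemma cluster_boundary_not_embedded:
  assumes "cluster \<xi> x" "x \<notin> j ` M"
  shows "\<xi> \<notin> \<iota> ` M"
proof
  assume "\<xi> \<in> \<iota> ` M"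
  then obtain q where q: "q \<in> M" "\<xi> = \<iota> q" by blast
  obtain z where "z \<in> M" "horo \<xi> z < - d q p" using horofunction_unbounded_below[OF assms] .
  then show False using horofunction_embed[OF q(1)] q(2) nonneg[of q z] by simp
qed

text \<open>A horofunction that clusters at \<open>x\<close> dominates the lower limit of \<open>d z w - d p w\<close> as \<open>w\<close> tends to \<open>x\<close>, since it is
  approximated by the values of this difference at points \<open>w\<close> arbitrarily close to \<open>x\<close>.\<close>

lemma horoball_subset_big_horosphere:
  assumes cl: "cluster \<xi> x"
  shows "horoball mtopology p \<xi> R \<subseteq> big_horo x R"
proof
  fix z assume "z \<in> horoball mtopology p \<xi> R"
  then have z: "z \<in> M" "horo \<xi> z < 1/2 * ln R" by (auto simp: horoball_def)
  obtain c where c: "horo \<xi> z < c" "c < 1/2 * ln R" using dense[OF z(2)] by blast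
  have "Liminf (approach x) (\<lambda>w. ereal (d z w - d p w)) < ereal (1/2 * ln R)"
  proof (rule ccontr)
    assume "\<not> ?thesis"
    then have "ereal c < Liminf (approach x) (\<lambda>w. ereal (d z w - d p w))"
      using c(2) by (metis ereal_less_eq(3) less_ereal.simps(1) not_less order.strict_trans2)
    then have "\<forall>\<^sub>F w in approach x. ereal c < ereal (d z w - d p w)" by (rule less_LiminfD)
    then obtain V where V: "openin E V" "x \<in> V" "\<And>w. w \<in> M \<Longrightarrow> j w \<in> V \<Longrightarrow> c < d z w - d p w"
      unfolding eventually_approach[OF clusterD(3)[OF cl]] by auto
    obtain w where w: "w \<in> M" "j w \<in> V" "\<And>y. y \<in> {z} \<Longrightarrow> \<bar>d w y - d w p - horo \<xi> y\<bar> < c - horo \<xi> z"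
      using cluster_uniformly[OF cl, of "{z}" "c - horo \<xi> z" V] V(1,2) z c by auto
    show False using V(3)[OF w(1,2)] w(3)[of z] commute[of w z] commute[of w p] by auto
  qed
  with z(1) show "z \<in> big_horo x R" by blast
qed

lemma convergent_subsequence:
  assumes "\<And>n. \<sigma> n \<in> topspace E"
  shows "\<exists>y r. strict_mono (r :: nat \<Rightarrow> nat) \<and> limitin E (\<sigma> \<circ> r) y sequentially"
proof -
  have "range \<sigma> \<subseteq> topspace E" using assms by blast
  then show ?thesis using seq_compact unfolding sequentially_compact_space_def by blast
qed

lemma limitin_in_closure:
  assumes y: "limitin E \<sigma> y sequentially" and S: "\<forall>\<^sub>F n in sequentially. \<sigma> n \<in> S"
  shows "y \<in> E closure_of S"
  unfolding in_closure_of
proof (intro conjI allI impI)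
  show "y \<in> topspace E" using y by (rule limitin_topspace)
  fix V assume "y \<in> V \<and> openin E V"
  then have "\<forall>\<^sub>F n in sequentially. \<sigma> n \<in> V" using y unfolding limitin_def by blast
  then have "\<forall>\<^sub>F n in sequentially. \<sigma> n \<in> S \<and> \<sigma> n \<in> V" using S by eventually_elim simp
  then show "\<exists>z. z \<in> S \<and> z \<in> V" unfolding eventually_sequentially by blast
qed

text \<open>The inclusion in the big horospheres leaves \<open>x\<close> as the only candidate. Points at which the
  horofunction tends to minus infinity exist and have a convergent subsequence in \<open>E\<close>; its limit belongs to the
  closure of every horoball, hence it is \<open>x\<close>.\<close>

lemma Inter_closure_horoballs:
  assumes cl: "cluster \<xi> x" and x: "x \<notin> j ` M"
  shows "(\<Inter>R\<in>{0<..}. E closure_of (j ` horoball mtopology p \<xi> R)) = {x}"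
proof -
  have xb: "x \<in> topspace E - j ` M" using clusterD(3)[OF cl] x by blast
  have sub: "(\<Inter>R\<in>{0<..}. E closure_of (j ` horoball mtopology p \<xi> R)) \<subseteq> {x}"
    unfolding big_horospheres[OF xb, symmetric]
    by (intro INF_mono' closure_of_mono image_mono horoball_subset_big_horosphere[OF cl])
  have "\<exists>z\<in>M. horo \<xi> z < - real n" for n
    using horofunction_unbounded_below[OF cl x, of "- real n"] by blast
  then obtain \<sigma> where \<sigma>: "\<And>n. \<sigma> n \<in> M" "\<And>n. horo \<xi> (\<sigma> n) < - real n" by metis
  obtain y r where r: "strict_mono (r :: nat \<Rightarrow> nat)" and y: "limitin E ((j \<circ> \<sigma>) \<circ> r) y sequentially"
    using convergent_subsequence[of "j \<circ> \<sigma>"] j_in[OF \<sigma>(1)] by auto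
  have "y \<in> E closure_of (j ` horoball mtopology p \<xi> R)" for R
  proof -
    obtain N where N: "- (1/2 * ln R) < real N" using reals_Archimedean2 by blast
    have "\<sigma> (r n) \<in> horoball mtopology p \<xi> R" if "N \<le> n" for n
      using \<sigma>[of "r n"] N that seq_suble[OF r, of n] by (simp add: horoball_def)
    then have "\<forall>\<^sub>F n in sequentially. ((j \<circ> \<sigma>) \<circ> r) n \<in> j ` horoball mtopology p \<xi> R"
      unfolding eventually_sequentially by auto
    then show ?thesis
      using limitin_in_closure[OF y] by simp
  qed
  with sub show ?thesis by blast
qed

lemma cluster_unique:
  assumes x: "cluster \<xi> x" and y: "cluster \<xi> y"
  shows "x = y"
proof (cases "x \<in> j ` M")
  case True
  then obtain q where q: "q \<in> M" "x = j q" by blast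
  then have \<xi>: "\<xi> = \<iota> q" using cluster_interior x by blast
  then have "y \<in> j ` M" using cluster_boundary_not_embedded[OF y] q by blast
  then obtain q' where q': "q' \<in> M" "y = j q'" by blast
  then have "\<xi> = \<iota> q'" using cluster_interior y by blast
  then show ?thesis using inj_embed[OF q(1) q'(1)] \<xi> q q' by simp
next
  case False
  then have "y \<notin> j ` M" using cluster_boundary_not_embedded[OF x] cluster_interior y by blast
  then show ?thesis using Inter_closure_horoballs[OF x False] Inter_closure_horoballs[OF y] by simp
qed

text \<open>The relation is closed under limits that are sequential in \<open>E\<close>; in the first factor the
  sequence follows a countable neighbourhood base.\<close>

lemma cluster_limit:
  assumes \<xi>: "\<xi> \<in> topspace compactified" and cl: "\<And>n. cluster (\<eta> n) (\<sigma> n)" and \<eta>: "\<And>n. \<eta> n \<in> nbhd_seq \<xi> n"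
    and r: "strict_mono (r :: nat \<Rightarrow> nat)" and x: "limitin E (\<sigma> \<circ> r) x sequentially"
  shows "cluster \<xi> x"
  unfolding cluster_def
proof (intro conjI allI impI \<xi>)
  show "x \<in> topspace E" using x by (rule limitin_topspace)
  fix U V assume U: "openin quotient_topology U" "\<xi> \<in> U" and V: "openin E V" "x \<in> V"
  obtain m where m: "nbhd_seq \<xi> m \<subseteq> U" using nbhd_seq_base[OF U] .
  have "\<forall>\<^sub>F n in sequentially. (\<sigma> \<circ> r) n \<in> V" using x V unfolding limitin_def by blast
  then obtain N where N: "\<And>n. N \<le> n \<Longrightarrow> \<sigma> (r n) \<in> V" unfolding eventually_sequentially by auto
  define n where "n = max m N"
  have "m \<le> r n" using seq_suble[OF r, of n] by (simp add: n_def)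
  then have "\<eta> (r n) \<in> U" using \<eta>[of "r n"] nbhd_seq_antimono[of m "r n" \<xi>] m by blast
  moreover have "\<sigma> (r n) \<in> V" using N by (simp add: n_def)
  ultimately show "\<exists>w\<in>M. \<iota> w \<in> U \<and> j w \<in> V"
    using clusterD(4)[OF cl[of "r n"] U(1) _ V(1)] by blast
qed

lemma cluster_total:
  assumes \<xi>: "\<xi> \<in> topspace compactified"
  shows "\<exists>x. cluster \<xi> x"
proof -
  have \<xi>q: "\<xi> \<in> topspace quotient_topology" by (rule compactified_in_quotient[OF \<xi>])
  have "\<exists>w\<in>M. \<iota> w \<in> nbhd_seq \<xi> n" for n
    using \<xi> openin_nbhd_seq[OF \<xi>q, of n] in_uniform_nbhd[OF \<xi>q, of "1 / real (Suc n)"]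
    unfolding topspace_compactified in_closure_of by auto
  then obtain w where w: "\<And>n. w n \<in> M" "\<And>n. \<iota> (w n) \<in> nbhd_seq \<xi> n" by metis
  obtain x r where "strict_mono (r :: nat \<Rightarrow> nat)" "limitin E ((j \<circ> w) \<circ> r) x sequentially"
    using convergent_subsequence[of "j \<circ> w"] j_in[OF w(1)] by auto
  then have "cluster \<xi> x"
    using cluster_limit[OF \<xi>, of "\<lambda>n. \<iota> (w n)" "j \<circ> w" r x] cluster_embed w by simp
  then show ?thesis by blast
qed

text \<open>A boundary point lies in the closure of its big horospheres, hence in the closure of \<open>M\<close>.\<close>

lemma approach_nontrivial:
  assumes x: "x \<in> topspace E - j ` M"
  shows "approach x \<noteq> bot"
proof
  assume "approach x = bot"
  then have "eventually (\<lambda>_. False) (approach x)" by simp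
  then obtain V where V: "openin E V" "x \<in> V" "\<And>w. w \<in> M \<Longrightarrow> j w \<notin> V"
    using x by (auto simp: eventually_approach)
  have "x \<in> (\<Inter>R\<in>{0<..}. E closure_of (j ` big_horo x R))" unfolding big_horospheres[OF x] by simp
  then have "x \<in> E closure_of (j ` big_horo x 1)" by (rule INT_D) simp
  then show False using V unfolding in_closure_of by blast
qed

text \<open>The first factor is compact, so points of \<open>M\<close> tending to \<open>x\<close> cluster at some class.\<close>

lemma cluster_onto:
  assumes x: "x \<in> topspace E"
  shows "\<exists>\<xi>. cluster \<xi> x"
proof (cases "x \<in> j ` M")
  case True
  then show ?thesis using cluster_embed by blast
next
  case False
  then have "approach x \<noteq> bot" using x by (intro approach_nontrivial) simp
  moreover have "eventually (\<lambda>w. w \<in> M) (approach x)"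
    unfolding approach_def eventually_inf_principal by simp
  ultimately obtain \<xi> where \<xi>: "\<xi> \<in> topspace compactified"
    "\<And>U P. openin quotient_topology U \<Longrightarrow> \<xi> \<in> U \<Longrightarrow> eventually P (approach x) \<Longrightarrow> \<exists>w\<in>M. P w \<and> \<iota> w \<in> U"
    using embed_cluster_point[of "approach x"] by metis
  have "cluster \<xi> x"
    unfolding cluster_def
  proof (intro conjI allI impI \<xi>(1) x)
    fix U V assume U: "openin quotient_topology U" "\<xi> \<in> U" and V: "openin E V" "x \<in> V"
    have "eventually (\<lambda>w. j w \<in> V) (approach x)" using V unfolding eventually_approach[OF x] by blast
    then show "\<exists>w\<in>M. \<iota> w \<in> U \<and> j w \<in> V" using \<xi>(2)[OF U] by blast
  qed
  then show ?thesis by blast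
qed

text \<open>A closed graph over a sequentially compact target gives continuity: if values near \<open>\<xi>\<close> left an open
  set around \<open>F \<xi>\<close>, a subsequence of them would converge to a second point related to \<open>\<xi>\<close>.\<close>

lemma continuous_extension_of_inclusion:
  "\<exists>F. continuous_map compactified E F \<and> F ` topspace compactified = topspace E \<and> (\<forall>z\<in>M. F (\<iota> z) = j z)"
proof -
  define F where "F = (\<lambda>\<xi>. SOME x. cluster \<xi> x)"
  have F: "cluster \<xi> (F \<xi>)" if "\<xi> \<in> topspace compactified" for \<xi>
    unfolding F_def using cluster_total[OF that] by (rule someI_ex)
  have F_eq: "F \<xi> = x" if "cluster \<xi> x" for \<xi> x
    using cluster_unique[OF F[OF clusterD(1)[OF that]] that] .
  have "continuous_map compactified E F"
    unfolding continuous_map_def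
  proof (intro conjI allI impI)
    show "F \<in> topspace compactified \<rightarrow> topspace E" using clusterD(3)[OF F] by blast
    fix W assume W: "openin E W"
    show "openin compactified {\<xi> \<in> topspace compactified. F \<xi> \<in> W}"
    proof (subst openin_subopen, clarify)
      fix \<xi> assume \<xi>: "\<xi> \<in> topspace compactified" and FW: "F \<xi> \<in> W"
      note \<xi>q = compactified_in_quotient[OF \<xi>]
      have "\<exists>n. \<forall>\<eta>\<in>nbhd_seq \<xi> n \<inter> topspace compactified. F \<eta> \<in> W"
      proof (rule ccontr)
        assume "\<not> ?thesis"
        then obtain \<eta> where \<eta>: "\<And>n. \<eta> n \<in> nbhd_seq \<xi> n" "\<And>n. \<eta> n \<in> topspace compactified" "\<And>n. F (\<eta> n) \<notin> W"
          by (metis IntE)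
        obtain y r where r: "strict_mono (r :: nat \<Rightarrow> nat)" and y: "limitin E ((F \<circ> \<eta>) \<circ> r) y sequentially"
          using convergent_subsequence[of "F \<circ> \<eta>"] clusterD(3)[OF F[OF \<eta>(2)]] by auto
        have "cluster \<xi> y"
          using cluster_limit[OF \<xi> _ \<eta>(1) r y] F[OF \<eta>(2)] by simp
        then have "y \<in> W" using F_eq FW by simp
        then have "\<forall>\<^sub>F n in sequentially. ((F \<circ> \<eta>) \<circ> r) n \<in> W" using y W unfolding limitin_def by blast
        then show False using \<eta>(3) by simp
      qed
      then obtain n where n: "\<And>\<eta>. \<eta> \<in> nbhd_seq \<xi> n \<Longrightarrow> \<eta> \<in> topspace compactified \<Longrightarrow> F \<eta> \<in> W" by blast
      have "openin compactified (topspace compactified \<inter> nbhd_seq \<xi> n)"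
        unfolding metric_compactification_def openin_subtopology topspace_subtopology
        using openin_nbhd_seq[OF \<xi>q, of n] openin_subset[OF openin_nbhd_seq[OF \<xi>q, of n]]
        by (intro exI[of _ "nbhd_seq \<xi> n"]) blast
      moreover have "\<xi> \<in> nbhd_seq \<xi> n" by (rule in_uniform_nbhd[OF \<xi>q]) simp
      ultimately show "\<exists>T. openin compactified T \<and> \<xi> \<in> T \<and> T \<subseteq> {\<xi> \<in> topspace compactified. F \<xi> \<in> W}"
        using \<xi> n by (intro exI[of _ "topspace compactified \<inter> nbhd_seq \<xi> n"]) auto
    qed
  qed
  moreover have "F ` topspace compactified = topspace E"
  proof
    show "F ` topspace compactified \<subseteq> topspace E" using clusterD(3)[OF F] by blast
    show "topspace E \<subseteq> F ` topspace compactified"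
    proof
      fix x assume "x \<in> topspace E"
      then obtain \<xi> where "cluster \<xi> x" using cluster_onto by blast
      then show "x \<in> F ` topspace compactified" using F_eq clusterD(1) by (metis imageI)
    qed
  qed
  moreover have "\<forall>z\<in>M. F (\<iota> z) = j z" using F_eq cluster_embed by blast
  ultimately show ?thesis by blast
qed

lemma cluster_if_sequence:
  assumes \<sigma>: "range \<sigma> \<subseteq> M" and x: "limitin E (j \<circ> \<sigma>) x sequentially"
    and \<xi>: "limitin compactified (\<iota> \<circ> \<sigma>) \<xi> sequentially"
  shows "cluster \<xi> x"
  unfolding cluster_def
proof (intro conjI allI impI)
  show "\<xi> \<in> topspace compactified" "x \<in> topspace E" using x \<xi> limitin_topspace by fast+
  fix U V assume U: "openin quotient_topology U" "\<xi> \<in> U" and V: "openin E V" "x \<in> V"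
  have "limitin quotient_topology (\<iota> \<circ> \<sigma>) \<xi> sequentially"
    using \<xi> unfolding metric_compactification_def limitin_subtopology by blast
  then have "\<forall>\<^sub>F n in sequentially. (\<iota> \<circ> \<sigma>) n \<in> U" using U unfolding limitin_def by blast
  moreover have "\<forall>\<^sub>F n in sequentially. (j \<circ> \<sigma>) n \<in> V" using x V unfolding limitin_def by blast
  ultimately have "\<forall>\<^sub>F n in sequentially. (\<iota> \<circ> \<sigma>) n \<in> U \<and> (j \<circ> \<sigma>) n \<in> V" by (rule eventually_conj)
  then obtain n where "\<iota> (\<sigma> n) \<in> U" "j (\<sigma> n) \<in> V" unfolding eventually_sequentially by auto
  then show "\<exists>w\<in>M. \<iota> w \<in> U \<and> j w \<in> V" using \<sigma> by blast
qed

end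

section \<open>Open and compact sets in the end compactification\<close>

lemma openin_end_topology_Inl:
  assumes "openin Y V"
  shows "openin (end_topology Y K) (Inl ` V)"
  unfolding openin_end_topology
proof (rule end_openI)
  show "Inl ` V \<subseteq> Inl ` topspace Y \<union> Inr ` ends Y K" using openin_subset[OF assms] by blast
qed (use assms in auto)

lemma compactin_subset_exhaustion:
  assumes K: "compact_exhaustion Y K" and C: "compactin Y C"
  obtains i where "C \<subseteq> K i"
proof -
  have int: "K i \<subseteq> Y interior_of K (Suc i)" for i
    using K by (simp add: compact_exhaustion_def)
  have mono: "K i \<subseteq> K i'" if "i \<le> i'" for i i'
    by (rule lift_Suc_mono_le[OF _ that]) (rule order_trans[OF int interior_of_subset])
  have "C \<subseteq> topspace Y" by (rule compactin_subset_topspace[OF C])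
  also have "topspace Y = (\<Union>i. K i)" using K by (simp add: compact_exhaustion_def)
  also have "\<dots> \<subseteq> \<Union> (range (\<lambda>i. Y interior_of K i))" using int by blast
  finally obtain \<F> where \<F>: "finite \<F>" "\<F> \<subseteq> range (\<lambda>i. Y interior_of K i)" "C \<subseteq> \<Union>\<F>"
    using compactinD[OF C, of "range (\<lambda>i. Y interior_of K i)"] openin_interior_of by blast
  then obtain I where I: "finite I" "\<F> = (\<lambda>i. Y interior_of K i) ` I"
    using finite_subset_image[OF \<F>(1,2)] by (elim exE conjE)
  have "C \<subseteq> K (Max (insert 0 I))"
  proof
    fix z assume "z \<in> C"
    then have "z \<in> (\<Union>i\<in>I. Y interior_of K i)" using \<F>(3) unfolding I(2) by (rule subsetD[rotated])
    then obtain i where i: "i \<in> I" "z \<in> Y interior_of K i" by (rule UN_E)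
    then have "i \<le> Max (insert 0 I)" using I(1) by simp
    then show "z \<in> K (Max (insert 0 I))" using mono subsetD[OF interior_of_subset i(2)] by blast
  qed
  then show ?thesis by (rule that)
qed

text \<open>A compact set lies in some member of the exhaustion, and the complement of that member contains a
  basic neighbourhood of each end.\<close>

lemma closedin_end_topology_Inl:
  assumes Y: "Hausdorff_space Y" and K: "compact_exhaustion Y K" and C: "compactin Y C"
  shows "closedin (end_topology Y K) (Inl ` C)"
  unfolding closedin_def topspace_end_topology openin_end_topology
proof (intro conjI end_openI)
  have CY: "C \<subseteq> topspace Y" by (rule compactin_subset_topspace[OF C])
  then show "Inl ` C \<subseteq> Inl ` topspace Y \<union> Inr ` ends Y K" by blast
  have "openin Y (topspace Y - C)" using compactin_imp_closedin[OF Y C] by blast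
  then show "\<exists>V. openin Y V \<and> z \<in> V \<and> Inl ` V \<subseteq> Inl ` topspace Y \<union> Inr ` ends Y K - Inl ` C"
    if "Inl z \<in> Inl ` topspace Y \<union> Inr ` ends Y K - Inl ` C" for z
    using that by (intro exI[of _ "topspace Y - C"]) auto
  fix F assume "Inr F \<in> Inl ` topspace Y \<union> Inr ` ends Y K - Inl ` C"
  then have F: "F \<in> ends Y K" by auto
  obtain i where i: "C \<subseteq> K i" using compactin_subset_exhaustion[OF K C] .
  have "F i \<in> connected_components_of (subtopology Y (topspace Y - K i))"
    using F by (simp add: ends_def)
  then have "F i \<subseteq> topspace Y - K i"
    using connected_components_of_subset by fastforce
  then show "\<exists>i. end_nbhd Y K F i \<subseteq> Inl ` topspace Y \<union> Inr ` ends Y K - Inl ` C"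
    using i by (intro exI[of _ i]) (auto simp: end_nbhd_def)
qed blast

section \<open>The Kobayashi distance of a complete hyperbolic domain\<close>

lemma mtopology_kobayashi:
  assumes mf: "complex_manifold X (A :: ('a set \<times> ('a \<Rightarrow> complex^'n::finite)) set)"
    and dom: "domain_in X \<Omega>" and met: "Metric_space \<Omega> (kobayashi X A \<Omega>)"
  shows "Metric_space.mtopology \<Omega> (kobayashi X A \<Omega>) = subtopology X \<Omega>"
proof -
  interpret Metric_space \<Omega> "kobayashi X A \<Omega>" by (rule met)
  have \<Omega>: "openin X \<Omega>" using dom by (simp add: domain_in_def)
  have haus: "Hausdorff_space X" using mf by (simp add: complex_manifold_def)
  show ?thesis
  proof (rule mtopology_eq_if_almost_geodesic)
    show "topspace (subtopology X \<Omega>) = \<Omega>" using openin_subset[OF \<Omega>] by auto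
    show "locally_compact_space (subtopology X \<Omega>)"
      using locally_compact_space_open_subset[OF _ locally_compact_complex_manifold[OF mf] \<Omega>] haus by blast
    show "Hausdorff_space (subtopology X \<Omega>)" using haus by (rule Hausdorff_space_subtopology)
    show "\<exists>N. openin (subtopology X \<Omega>) N \<and> x \<in> N \<and> (\<forall>y\<in>N. kobayashi X A \<Omega> x y < \<epsilon>)"
      if x: "x \<in> \<Omega>" and \<epsilon>: "0 < \<epsilon>" for x \<epsilon>
    proof -
      obtain N where "openin X N" "x \<in> N" "N \<subseteq> \<Omega>" "\<And>y. y \<in> N \<Longrightarrow> kobayashi X A \<Omega> x y < \<epsilon>"
        using kobayashi_small_near_point[OF mf \<Omega> x \<epsilon>] by metis
      then show ?thesis by (intro exI[of _ N]) (simp add: openin_open_subtopology[OF \<Omega>])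
    qed
    show "\<exists>C. connectedin (subtopology X \<Omega>) C \<and> x \<in> C \<and> y \<in> C \<and>
        (\<forall>z\<in>C. kobayashi X A \<Omega> x z + kobayashi X A \<Omega> z y < kobayashi X A \<Omega> x y + \<epsilon>)"
      if "x \<in> \<Omega>" "y \<in> \<Omega>" "0 < \<epsilon>" for x y \<epsilon>
      using kobayashi_almost_geodesic[OF mf dom met that] unfolding connectedin_subtopology by metis
  qed
qed

theorem proposition5p2:
  fixes X :: "'a topology"
    and A :: "('a set \<times> ('a \<Rightarrow> complex^'n::finite)) set"
    and \<Omega> :: "'a set"
    and K :: "nat \<Rightarrow> 'a set"
    and p :: 'a
  assumes "complex_manifold X A"
    and "domain_in X \<Omega>" and "\<Omega> \<subset> topspace X"
    and "complete_kobayashi_hyperbolic X A \<Omega>"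
    and "compact_exhaustion (subtopology X (X closure_of \<Omega>)) K"
    and "sequentially_compact_space (end_compactification X \<Omega> K)"
    and "p \<in> \<Omega>"
    and "\<forall>x \<in> end_boundary X \<Omega> K.
           (\<Inter>R\<in>{0<..}. end_compactification X \<Omega> K closure_of
                          (Inl ` big_horosphere X A \<Omega> K p x R)) = {x}"
  shows "(\<forall>x \<in> end_boundary X \<Omega> K. \<forall>\<xi> \<in> horofunctions_at X A \<Omega> K x.
            (\<Inter>R\<in>{0<..}. end_compactification X \<Omega> K closure_of
                           (Inl ` horoball (subtopology X \<Omega>) p \<xi> R)) = {x})
       \<and> (\<exists>F. continuous_map (metric_compactification (subtopology X \<Omega>) (kobayashi X A \<Omega>))
                              (end_compactification X \<Omega> K) F
             \<and> F ` topspace (metric_compactification (subtopology X \<Omega>) (kobayashi X A \<Omega>))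
                 = topspace (end_compactification X \<Omega> K)
             \<and> (\<forall>z\<in>\<Omega>. F (metric_embedding (subtopology X \<Omega>) (kobayashi X A \<Omega>) z) = Inl z))"
proof -
  let ?d = "kobayashi X A \<Omega>" and ?Y = "subtopology X (X closure_of \<Omega>)"
  have met: "Metric_space \<Omega> ?d" and compl: "Metric_space.mcomplete \<Omega> ?d"
    using assms(4) by (simp_all add: complete_kobayashi_hyperbolic_def)
  have \<Omega>: "openin X \<Omega>" using assms(2) by (simp add: domain_in_def)
  have haus: "Hausdorff_space X" using assms(1) by (simp add: complex_manifold_def)
  have sub: "\<Omega> \<subseteq> X closure_of \<Omega>" using closure_of_subset[OF openin_subset[OF \<Omega>]] .
  interpret Metric_space \<Omega> ?d by (rule met)
  have top: "mtopology = subtopology X \<Omega>" by (rule mtopology_kobayashi[OF assms(1,2) met])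
  have loc: "locally_compact_space mtopology"
    unfolding top
    using locally_compact_space_open_subset[OF _ locally_compact_complex_manifold[OF assms(1)] \<Omega>] haus by blast
  have geo: "\<exists>z\<in>\<Omega>. ?d x z = t \<and> ?d z y < ?d x y - t + \<epsilon>"
    if xy: "x \<in> \<Omega>" "y \<in> \<Omega>" and t: "0 \<le> t" "t \<le> ?d x y" and \<epsilon>: "0 < \<epsilon>" for x y t \<epsilon>
  proof -
    obtain C where "connectedin X C" "C \<subseteq> \<Omega>" "x \<in> C" "y \<in> C" "\<And>z. z \<in> C \<Longrightarrow> ?d x z + ?d z y < ?d x y + \<epsilon>"
      using kobayashi_almost_geodesic[OF assms(1,2) met xy \<epsilon>] by metis
    then show ?thesis
      by (intro point_at_distance_on_almost_geodesic[of C] t) (auto simp: top connectedin_subtopology)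
  qed
  have proper: "compactin mtopology (mcball x r)" for x r
    using compl loc geo by (rule compactin_mcball_if_almost_geodesic)
  interpret H: horospherical_compactification \<Omega> ?d p "end_compactification X \<Omega> K" Inl "tending_to X \<Omega> K"
  proof unfold_locales
    show "p \<in> \<Omega>" by (rule assms(7))
    show "compactin mtopology (mcball x r)" for x r by (rule proper)
    show "\<exists>z\<in>\<Omega>. ?d x z = t \<and> ?d z y < ?d x y - t + \<epsilon>"
      if "x \<in> \<Omega>" "y \<in> \<Omega>" "0 \<le> t" "t \<le> ?d x y" "0 < \<epsilon>" for x y t \<epsilon>
      using that by (rule geo)
    show "inj_on Inl \<Omega>" by simp
    show "openin (end_compactification X \<Omega> K) (Inl ` U)" if "openin mtopology U" for U
    proof -
      have "openin X U" "U \<subseteq> \<Omega>" using that unfolding top openin_open_subtopology[OF \<Omega>] by auto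
      then have "openin ?Y U" using sub by (metis inf.absorb1 openin_subtopology_Int order_trans)
      then show ?thesis unfolding end_compactification_def by (rule openin_end_topology_Inl)
    qed
    show "closedin (end_compactification X \<Omega> K) (Inl ` C)" if "compactin mtopology C" for C
    proof -
      have "compactin ?Y C" using that sub unfolding top compactin_subtopology by blast
      then show ?thesis
        unfolding end_compactification_def
        by (rule closedin_end_topology_Inl[OF Hausdorff_space_subtopology[OF haus] assms(5)])
    qed
    show "sequentially_compact_space (end_compactification X \<Omega> K)" by (rule assms(6))
    show "tending_to X \<Omega> K x = inf (filtercomap Inl (nhdsin (end_compactification X \<Omega> K) x)) (principal \<Omega>)" for x
      by (rule tending_to_def)
    show "(\<Inter>R\<in>{0<..}. end_compactification X \<Omega> K closure_of (Inl ` {z \<in> \<Omega>.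
          Liminf (tending_to X \<Omega> K x) (\<lambda>w. ereal (?d z w - ?d p w)) < ereal (1/2 * ln R)})) = {x}"
      if "x \<in> topspace (end_compactification X \<Omega> K) - Inl ` \<Omega>" for x
      using bspec[OF assms(8), of x] that unfolding end_boundary_def big_horosphere_def by blast
  qed
  have "(\<Inter>R\<in>{0<..}. end_compactification X \<Omega> K closure_of (Inl ` horoball (subtopology X \<Omega>) p \<xi> R)) = {x}"
    if x: "x \<in> end_boundary X \<Omega> K" and \<xi>: "\<xi> \<in> horofunctions_at X A \<Omega> K x" for x \<xi>
  proof -
    obtain \<sigma> :: "nat \<Rightarrow> 'a" where "range \<sigma> \<subseteq> \<Omega>" "limitin (end_compactification X \<Omega> K) (Inl \<circ> \<sigma>) x sequentially"
      "limitin H.compactified (H.\<iota> \<circ> \<sigma>) \<xi> sequentially"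
      using \<xi> unfolding horofunctions_at_def top by blast
    then have "H.cluster \<xi> x" by (rule H.cluster_if_sequence)
    moreover have "x \<notin> Inl ` \<Omega>" using x by (simp add: end_boundary_def)
    ultimately show ?thesis using H.Inter_closure_horoballs unfolding top by blast
  qed
  then show ?thesis using H.continuous_extension_of_inclusion unfolding top by blast
qed

end
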